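(* Let $p$ be a prime and let $G$ be a finite $p$-group that is a VZ-group. Then $$\delta(G)=d(\mathcal{Z}(G))-d(G')+d(G')\,|G:\mathcal{Z}(G)|^{1/2}.$$
   Context: All groups are finite and all representations and characters are over $\mathbb{C}$. The representation dimension $\delta(G)$ is the least dimension of a faithful (not necessarily irreducible) complex representation of $G$, i.e. the smallest positive integer $n$ such that $G$ embeds into $\mathrm{GL}_n(\mathbb{C})$. $\mathcal{Z}(G)$ is the center of $G$, $G'$ is the commutator subgroup of $G$, and $d(A)$ is the minimal number of generators of a group $A$. A group $G$ is a VZ-group if every nonlinear irreducible character $\chi$ of $G$ (that is, $\chi(1)>1$) vanishes on $G\setminus\mathcal{Z}(G)$.
   Formalization: The group G is assumed nontrivial: for the trivial group the definition of δ(G) as a smallest positive integer gives δ(G) = 1, whereas the right-hand side of the formula is 0. *)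

theory Defs
  imports
    "HOL-Algebra.Generated_Groups"
    "HOL-Library.Complex_Order"
    "HOL-Computational_Algebra.Primes"
    "Jordan_Normal_Form.VS_Connect"
begin

definition GL :: "nat \<Rightarrow> complex mat monoid" where
  "GL n = units_of (ring_mat TYPE(complex) n ())"

definition representation :: "('a, 'b) monoid_scheme \<Rightarrow> nat \<Rightarrow> ('a \<Rightarrow> complex mat) \<Rightarrow> bool" where
  "representation G n \<rho> \<longleftrightarrow> \<rho> \<in> hom G (GL n)"

definition faithful_representation :: "('a, 'b) monoid_scheme \<Rightarrow> nat \<Rightarrow> ('a \<Rightarrow> complex mat) \<Rightarrow> bool" where
  "faithful_representation G n \<rho> \<longleftrightarrow> representation G n \<rho> \<and> inj_on \<rho> (carrier G)"

(* Only positive dimensions are allowed, so the value at the trivial group is 1 and not 0. *)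
definition rep_dim :: "('a, 'b) monoid_scheme \<Rightarrow> nat" where
  "rep_dim G = (LEAST n. 0 < n \<and> (\<exists>\<rho>. faithful_representation G n \<rho>))"

definition irreducible_representation ::
  "('a, 'b) monoid_scheme \<Rightarrow> nat \<Rightarrow> ('a \<Rightarrow> complex mat) \<Rightarrow> bool" where
  "irreducible_representation G n \<rho> \<longleftrightarrow>
     representation G n \<rho> \<and> 0 < n \<and>
     (\<forall>W. VectorSpace.subspace class_ring W (module_vec TYPE(complex) n) \<longrightarrow>
          (\<forall>g\<in>carrier G. \<forall>w\<in>W. \<rho> g *\<^sub>v w \<in> W) \<longrightarrow>
          W = {0\<^sub>v n} \<or> W = carrier_vec n)"

definition mat_trace :: "complex mat \<Rightarrow> complex" where
  "mat_trace A = (\<Sum>i<dim_row A. A $$ (i, i))"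

definition character :: "('a, 'b) monoid_scheme \<Rightarrow> ('a \<Rightarrow> complex mat) \<Rightarrow> 'a \<Rightarrow> complex" where
  "character G \<rho> = (\<lambda>g\<in>carrier G. mat_trace (\<rho> g))"

definition irreducible_characters :: "('a, 'b) monoid_scheme \<Rightarrow> ('a \<Rightarrow> complex) set" where
  "irreducible_characters G = {character G \<rho> | n \<rho>. irreducible_representation G n \<rho>}"

definition center :: "('a, 'b) monoid_scheme \<Rightarrow> 'a set" where
  "center G = {z \<in> carrier G. \<forall>g\<in>carrier G. z \<otimes>\<^bsub>G\<^esub> g = g \<otimes>\<^bsub>G\<^esub> z}"

(* The comparison with 1 is in the order on complex, where x < y means
   Re x < Re y and Im x = Im y; the value at the identity is the degree. *)
definition VZ_group :: "('a, 'b) monoid_scheme \<Rightarrow> bool" where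
  "VZ_group G \<longleftrightarrow> group G \<and> finite (carrier G) \<and>
     (\<forall>\<chi>\<in>irreducible_characters G. \<chi> \<one>\<^bsub>G\<^esub> > 1 \<longrightarrow>
        (\<forall>g\<in>carrier G - center G. \<chi> g = 0))"

definition min_generators :: "('a, 'b) monoid_scheme \<Rightarrow> nat" where
  "min_generators A =
     (LEAST n. \<exists>S. S \<subseteq> carrier A \<and> finite S \<and> card S = n \<and> generate A S = carrier A)"

end

theory Submission
  imports
    Defs
    "HOL-Algebra.Multiplicative_Group"
    "Jordan_Normal_Form.Spectral_Radius"
    "Jordan_Normal_Form.DL_Rank"
begin

text \<open>Everything is read off the composition factors of suitable matrix representations.
  Schur's lemma gives $\sum_g \chi(g)\chi(g^{-1}) = |G|$ for irreducible $\chi$; for a nonlinear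
  character of a VZ-group only the centre contributes, so its degree $m$ satisfies
  $m^2 = |G:Z|$. The trace of the regular representation at a noncentral commutator would count
  the linear constituents, so $G' \subseteq Z$. For an abelian p-group $A$ the subgroup
  $\Omega(A) = \{x. x^p = 1\}$ has order $p^{d(A)}$, and a representation is faithful as soon as it is
  faithful on $\Omega(Z)$. Each irreducible constituent acts on $\Omega(Z)$ by scalars that are p-th
  roots of unity, and the linear ones are trivial on $\Omega(G')$. Hence a faithful
  representation needs at least $d(Z)$ constituents, at least $d(G')$ of them nonlinear; and a
  greedy choice attains both bounds, using linear constituents to cut the kernel on
  $\Omega(Z)$ down to $\Omega(G')$ and nonlinear ones to cut it down to 1.\<close>

section \<open>Matrix representations\<close>

text \<open>Counting replaces structure theory. Neither a complement of an invariant subspace nor a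
  cyclic decomposition of the centre is constructed: traces add along composition factors, and the
  rank of an abelian p-group A enters only through |A : A^p| = |Omega(A)|. Independence of
  characters also becomes a matter of cardinality: r scalar characters with trivial common kernel
  embed the group into r copies of the p-th roots of unity, while every proper step down in a chain
  of p-subgroups costs a factor of at least p. Omega(Z) decides faithfulness because a nontrivial
  kernel K meets the centre: [K,G] lies in K and in G', hence in Z, so K is central unless [K,G]
  already gives a nontrivial central element; a power of such an element has order p. With l
  constituents, t of them nonlinear of degree m, the dimension is l + t(m - 1). It does not decrease
  when l or t grows, so the separate minima for l and t can be combined; the construction supplies
  matching inequalities only, and the lower bound forces equality. Nonlinear constituents need not
  exist; then G' is trivial and m is multiplied by 0.\<close>

lemma representation_iff:
  assumes "group G"
  shows "representation G n \<rho> \<longleftrightarrow>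
    (\<forall>g\<in>carrier G. \<rho> g \<in> carrier_mat n n) \<and> \<rho> \<one>\<^bsub>G\<^esub> = 1\<^sub>m n \<and>
    (\<forall>g\<in>carrier G. \<forall>h\<in>carrier G. \<rho> (g \<otimes>\<^bsub>G\<^esub> h) = \<rho> g * \<rho> h)" (is "?L \<longleftrightarrow> ?R")
proof -
  interpret group G by fact
  interpret R: ring "ring_mat TYPE(complex) n ()" by (rule ring_mat)
  have GL: "group (GL n)" unfolding GL_def by (rule R.units_group)
  have carr: "x \<in> carrier_mat n n" if "x \<in> carrier (GL n)" for x
    using that unfolding GL_def units_of_def Units_def by (simp add: ring_mat_simps)
  show ?thesis
  proof
    assume L: ?L
    then interpret group_hom G "GL n" \<rho>
      using GL unfolding representation_def by (intro group_hom.intro group_axioms) (auto simp: group_hom_axioms_def)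
    have "\<rho> \<one>\<^bsub>G\<^esub> = 1\<^sub>m n" using hom_one by (simp add: GL_def units_of_def ring_mat_simps)
    moreover have "\<rho> (g \<otimes>\<^bsub>G\<^esub> h) = \<rho> g * \<rho> h" if "g \<in> carrier G" "h \<in> carrier G" for g h
      using hom_mult[OF that] by (simp add: GL_def units_of_def ring_mat_simps)
    moreover have "\<rho> g \<in> carrier_mat n n" if "g \<in> carrier G" for g
      using carr hom_closed that by blast
    ultimately show ?R by blast
  next
    assume R: ?R
    \<comment> \<open>Invertibility is automatic for a multiplicative map that sends the identity to
      the identity matrix: the image of the group inverse is the matrix inverse. Later constructions
      therefore only check closure, identity and products.\<close>
    have unit: "\<rho> g \<in> Units (ring_mat TYPE(complex) n ())" if g: "g \<in> carrier G" for g
    proof -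
      have "\<rho> (inv\<^bsub>G\<^esub> g) * \<rho> g = 1\<^sub>m n" "\<rho> g * \<rho> (inv\<^bsub>G\<^esub> g) = 1\<^sub>m n"
        using R g by (metis inv_closed l_inv r_inv)+
      then show ?thesis using R g inv_closed unfolding Units_def
        by (auto simp: ring_mat_simps intro!: bexI[of _ "\<rho> (inv\<^bsub>G\<^esub> g)"])
    qed
    then show ?L using R unfolding representation_def hom_def GL_def units_of_def
      by (auto simp: ring_mat_simps)
  qed
qed

lemma representation_carrier:
  assumes "group G" "representation G n \<rho>" "g \<in> carrier G"
  shows "\<rho> g \<in> carrier_mat n n"
  using assms representation_iff[OF assms(1)] by blast

lemma representation_one:
  assumes "group G" "representation G n \<rho>"
  shows "\<rho> \<one>\<^bsub>G\<^esub> = 1\<^sub>m n"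
  using assms representation_iff[OF assms(1)] by blast

lemma representation_mult:
  assumes "group G" "representation G n \<rho>" "g \<in> carrier G" "h \<in> carrier G"
  shows "\<rho> (g \<otimes>\<^bsub>G\<^esub> h) = \<rho> g * \<rho> h"
  using assms representation_iff[OF assms(1)] by blast

lemma representation_inv:
  assumes "group G" "representation G n \<rho>" "g \<in> carrier G"
  shows "\<rho> g * \<rho> (inv\<^bsub>G\<^esub> g) = 1\<^sub>m n" "\<rho> (inv\<^bsub>G\<^esub> g) * \<rho> g = 1\<^sub>m n"
proof -
  interpret group G by fact
  show "\<rho> g * \<rho> (inv\<^bsub>G\<^esub> g) = 1\<^sub>m n" "\<rho> (inv\<^bsub>G\<^esub> g) * \<rho> g = 1\<^sub>m n"
    using representation_mult[OF assms(1,2)] representation_one[OF assms(1,2)] assms(3)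
    by (metis inv_closed l_inv r_inv)+
qed

text \<open>The kernel is cut with a subgroup \<open>W\<close> so that it can be iterated:
  \<open>W\<close> is the whole group for an ordinary kernel, and the part still to be separated in
  the greedy construction.\<close>

lemma representation_kernel_subgroup:
  assumes G: "group G" and \<rho>: "representation G n \<rho>" and W: "subgroup W G"
  shows "subgroup {w\<in>W. \<rho> w = 1\<^sub>m n} G"
proof -
  interpret group G by fact
  interpret W: subgroup W G by fact
  show ?thesis
  proof (rule subgroupI)
    show "{w\<in>W. \<rho> w = 1\<^sub>m n} \<noteq> {}" using W.one_closed representation_one[OF G \<rho>] by blast
    fix a assume a: "a \<in> {w\<in>W. \<rho> w = 1\<^sub>m n}"
    then have ac: "a \<in> carrier G" by simp
    have "\<rho> (inv\<^bsub>G\<^esub> a) = 1\<^sub>m n"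
      using representation_inv(1)[OF G \<rho> ac] a representation_carrier[OF G \<rho> inv_closed[OF ac]] by simp
    then show "inv\<^bsub>G\<^esub> a \<in> {w\<in>W. \<rho> w = 1\<^sub>m n}" using a by simp
  next
    fix a b assume "a \<in> {w\<in>W. \<rho> w = 1\<^sub>m n}" "b \<in> {w\<in>W. \<rho> w = 1\<^sub>m n}"
    then show "a \<otimes>\<^bsub>G\<^esub> b \<in> {w\<in>W. \<rho> w = 1\<^sub>m n}"
      by (simp add: representation_mult[OF G \<rho>])
  qed auto
qed

section \<open>Traces and block matrices\<close>

lemma mat_trace_mult_comm:
  assumes "A \<in> carrier_mat n m" "B \<in> carrier_mat m n"
  shows "mat_trace (A * B) = mat_trace (B * A)"
proof -
  have "mat_trace (A * B) = (\<Sum>i<n. \<Sum>j<m. A $$ (i,j) * B $$ (j,i))"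
    using assms unfolding mat_trace_def
    by (auto simp: scalar_prod_def atLeast0LessThan intro!: sum.cong)
  also have "\<dots> = (\<Sum>j<m. \<Sum>i<n. B $$ (j,i) * A $$ (i,j))"
    by (subst sum.swap) (simp add: mult.commute)
  also have "\<dots> = mat_trace (B * A)"
    using assms unfolding mat_trace_def
    by (auto simp: scalar_prod_def atLeast0LessThan intro!: sum.cong)
  finally show ?thesis .
qed

lemma mat_trace_four_block:
  assumes "A \<in> carrier_mat n n" "D \<in> carrier_mat m m"
  shows "mat_trace (four_block_mat A B C D) = mat_trace A + mat_trace D"
proof -
  have "mat_trace (four_block_mat A B C D) =
      (\<Sum>i<n+m. if i < n then A $$ (i,i) else D $$ (i - n, i - n))"
    using assms unfolding mat_trace_def by (auto intro!: sum.cong)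
  also have "{..<n+m} = {..<n} \<union> {n..<n+m}" by auto
  also have "(\<Sum>i\<in>{..<n} \<union> {n..<n+m}. if i < n then A $$ (i,i) else D $$ (i - n, i - n)) =
      (\<Sum>i<n. A $$ (i,i)) + (\<Sum>i\<in>{n..<n+m}. D $$ (i - n, i - n))"
    by (subst sum.union_disjoint) (auto intro!: sum.cong)
  also have "(\<Sum>i\<in>{n..<n+m}. D $$ (i - n, i - n)) = (\<Sum>i<m. D $$ (i,i))"
    by (rule sum.reindex_bij_witness[of _ "\<lambda>i. i + n" "\<lambda>i. i - n"]) auto
  finally show ?thesis using assms by (simp add: mat_trace_def)
qed

lemma mat_trace_one [simp]: "mat_trace (1\<^sub>m n) = of_nat n"
  by (simp add: mat_trace_def)

lemma mat_trace_smult: "mat_trace (c \<cdot>\<^sub>m A) = c * mat_trace A" if "A \<in> carrier_mat n n"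
  using that by (simp add: mat_trace_def sum_distrib_left)

lemma four_block_mat_inject:
  assumes c: "A \<in> carrier_mat n n" "B \<in> carrier_mat n m" "C \<in> carrier_mat m n" "D \<in> carrier_mat m m"
    and c': "A' \<in> carrier_mat n n" "B' \<in> carrier_mat n m" "C' \<in> carrier_mat m n" "D' \<in> carrier_mat m m"
  shows "four_block_mat A B C D = four_block_mat A' B' C' D' \<longleftrightarrow> A = A' \<and> B = B' \<and> C = C' \<and> D = D'"
    (is "?L \<longleftrightarrow> ?R")
proof
  assume L: ?L
  have e: "four_block_mat A B C D $$ (i,j) = four_block_mat A' B' C' D' $$ (i,j)" for i j
    using L by simp
  show ?R
  proof (intro conjI)
    show "A = A'"
    proof (rule eq_matI)
      fix i j assume "i < dim_row A'" "j < dim_col A'"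
      then show "A $$ (i,j) = A' $$ (i,j)" using e[of i j] c c' by auto
    qed (use c c' in auto)
    show "B = B'"
    proof (rule eq_matI)
      fix i j assume "i < dim_row B'" "j < dim_col B'"
      then show "B $$ (i,j) = B' $$ (i,j)" using e[of i "n + j"] c c' by auto
    qed (use c c' in auto)
    show "C = C'"
    proof (rule eq_matI)
      fix i j assume "i < dim_row C'" "j < dim_col C'"
      then show "C $$ (i,j) = C' $$ (i,j)" using e[of "n + i" j] c c' by auto
    qed (use c c' in auto)
    show "D = D'"
    proof (rule eq_matI)
      fix i j assume "i < dim_row D'" "j < dim_col D'"
      then show "D $$ (i,j) = D' $$ (i,j)" using e[of "n + i" "n + j"] c c' by auto
    qed (use c c' in auto)
  qed
qed simp

text \<open>The block diagonal sum. Kernels intersect, which is the only property of the sum that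
  the construction of a faithful representation uses.\<close>

lemma representation_direct_sum:
  assumes G: "group G" and \<rho>: "representation G n \<rho>" and \<sigma>: "representation G m \<sigma>"
  shows "\<exists>\<tau>. representation G (n + m) \<tau> \<and>
    (\<forall>g\<in>carrier G. \<tau> g = 1\<^sub>m (n + m) \<longleftrightarrow> \<rho> g = 1\<^sub>m n \<and> \<sigma> g = 1\<^sub>m m)"
proof -
  define \<tau> where "\<tau> = (\<lambda>g. four_block_mat (\<rho> g) (0\<^sub>m n m) (0\<^sub>m m n) (\<sigma> g))"
  note c = representation_carrier[OF G \<rho>] representation_carrier[OF G \<sigma>]
  have "representation G (n + m) \<tau>"
    unfolding representation_iff[OF G] \<tau>_def
  proof (intro conjI ballI)
    fix g h assume gh: "g \<in> carrier G" "h \<in> carrier G"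
    show "four_block_mat (\<rho> (g \<otimes>\<^bsub>G\<^esub> h)) (0\<^sub>m n m) (0\<^sub>m m n) (\<sigma> (g \<otimes>\<^bsub>G\<^esub> h)) =
       four_block_mat (\<rho> g) (0\<^sub>m n m) (0\<^sub>m m n) (\<sigma> g) * four_block_mat (\<rho> h) (0\<^sub>m n m) (0\<^sub>m m n) (\<sigma> h)"
      using c[OF gh(1)] c[OF gh(2)]
      by (simp add: representation_mult[OF G \<rho> gh] representation_mult[OF G \<sigma> gh]
          mult_four_block_mat[of _ n n _ m _ m _ _ n _ m])
  qed (use c representation_one[OF G \<rho>] representation_one[OF G \<sigma>] in auto)
  moreover have "\<tau> g = 1\<^sub>m (n + m) \<longleftrightarrow> \<rho> g = 1\<^sub>m n \<and> \<sigma> g = 1\<^sub>m m" if "g \<in> carrier G" for g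
    unfolding \<tau>_def four_block_one_mat[symmetric]
    using c(1)[OF that] c(2)[OF that]
    by (subst four_block_mat_inject[of _ n _ m]) auto
  ultimately show ?thesis by blast
qed

section \<open>Schur's lemma and composition factors\<close>

abbreviation invariant_subspace ::
  "('a, 'b) monoid_scheme \<Rightarrow> nat \<Rightarrow> ('a \<Rightarrow> complex mat) \<Rightarrow> complex vec set \<Rightarrow> bool" where
  "invariant_subspace G n \<rho> W \<equiv> VectorSpace.subspace class_ring W (module_vec TYPE(complex) n) \<and>
     (\<forall>g\<in>carrier G. \<forall>w\<in>W. \<rho> g *\<^sub>v w \<in> W)"

lemma subspace_vecI:
  assumes "W \<subseteq> carrier_vec n" "0\<^sub>v n \<in> W"
    and "\<And>v w. v \<in> W \<Longrightarrow> w \<in> W \<Longrightarrow> v + w \<in> W" "\<And>c v. v \<in> W \<Longrightarrow> c \<cdot>\<^sub>v v \<in> W"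
  shows "VectorSpace.subspace class_ring W (module_vec TYPE(complex) n)"
  using assms
  by (auto intro!: VectorSpace.subspace.intro submodule.intro vec_vs vec_module simp: module_vec_simps)

lemma irreducible_representationD:
  assumes "irreducible_representation G n \<rho>"
  shows "representation G n \<rho>" "0 < n"
    and "invariant_subspace G n \<rho> W \<Longrightarrow> W \<noteq> {0\<^sub>v n} \<Longrightarrow> W = carrier_vec n"
  using assms unfolding irreducible_representation_def by blast+

lemma eq_smult_one_matI:
  fixes A :: "complex mat"
  assumes A: "A \<in> carrier_mat n n" and eig: "\<And>v. v \<in> carrier_vec n \<Longrightarrow> A *\<^sub>v v = c \<cdot>\<^sub>v v"
  shows "A = c \<cdot>\<^sub>m 1\<^sub>m n"
proof (rule eq_matI)
  fix i j assume "i < dim_row (c \<cdot>\<^sub>m 1\<^sub>m n)" "j < dim_col (c \<cdot>\<^sub>m 1\<^sub>m n)"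
  then have ij: "i < n" "j < n" by auto
  have "A $$ (i,j) = (A *\<^sub>v unit_vec n j) $ i" using A ij by (simp add: scalar_prod_right_unit)
  also have "A *\<^sub>v unit_vec n j = c \<cdot>\<^sub>v unit_vec n j" using eig by simp
  finally show "A $$ (i,j) = (c \<cdot>\<^sub>m 1\<^sub>m n) $$ (i,j)" using ij by (auto simp: unit_vec_def)
qed (use A in auto)

text \<open>Over the complex numbers \<open>X\<close> has an eigenvalue. Its eigenspace is nonzero
  and, because \<open>X\<close> commutes with every \<open>\<rho> g\<close>, invariant;
  irreducibility makes it the whole space.\<close>

lemma schur:
  assumes G: "group G" and irr: "irreducible_representation G n \<rho>" and X: "X \<in> carrier_mat n n"
    and comm: "\<And>g. g \<in> carrier G \<Longrightarrow> \<rho> g * X = X * \<rho> g"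
  shows "\<exists>c. X = c \<cdot>\<^sub>m 1\<^sub>m n"
proof -
  note irrD = irreducible_representationD[OF irr]
  obtain c where "eigenvalue X c"
    using spectrum_non_empty[OF X irrD(2)] unfolding spectrum_def by blast
  then obtain v where v: "v \<in> carrier_vec n" "v \<noteq> 0\<^sub>v n" "X *\<^sub>v v = c \<cdot>\<^sub>v v"
    using X unfolding eigenvalue_def eigenvector_def by auto
  define W where "W = {v \<in> carrier_vec n. X *\<^sub>v v = c \<cdot>\<^sub>v v}"
  have "VectorSpace.subspace class_ring W (module_vec TYPE(complex) n)"
  proof (rule subspace_vecI)
    fix v w assume "v \<in> W" "w \<in> W"
    then show "v + w \<in> W"
      unfolding W_def using X by (auto simp: mult_add_distrib_mat_vec smult_add_distrib_vec)
  next
    fix d v assume "v \<in> W"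
    then show "d \<cdot>\<^sub>v v \<in> W"
      unfolding W_def using X by (auto simp: mult_mat_vec smult_smult_assoc mult.commute)
  qed (use X in \<open>auto simp: W_def\<close>)
  moreover have "\<rho> g *\<^sub>v w \<in> W" if "g \<in> carrier G" "w \<in> W" for g w
  proof -
    have g: "\<rho> g \<in> carrier_mat n n" by (rule representation_carrier[OF G irrD(1) that(1)])
    have w: "w \<in> carrier_vec n" "X *\<^sub>v w = c \<cdot>\<^sub>v w" using that(2) by (auto simp: W_def)
    have "X *\<^sub>v (\<rho> g *\<^sub>v w) = (X * \<rho> g) *\<^sub>v w" using X g w by simp
    also have "\<dots> = \<rho> g *\<^sub>v (X *\<^sub>v w)" using X g w by (simp flip: comm[OF that(1)])
    also have "\<dots> = c \<cdot>\<^sub>v (\<rho> g *\<^sub>v w)" using g w by (simp add: mult_mat_vec)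
    finally show ?thesis using g w by (simp add: W_def)
  qed
  moreover have "W \<noteq> {0\<^sub>v n}" using v by (auto simp: W_def)
  ultimately have "W = carrier_vec n" using irrD(3)[of W] by blast
  then have "X *\<^sub>v u = c \<cdot>\<^sub>v u" if "u \<in> carrier_vec n" for u using that unfolding W_def by blast
  then have "X = c \<cdot>\<^sub>m 1\<^sub>m n" by (rule eq_smult_one_matI[OF X])
  then show ?thesis ..
qed

text \<open>By Schur's lemma every \<open>\<rho> g\<close> is scalar, so every subspace is
  invariant. The first coordinate axis is then a proper nonzero invariant subspace unless the
  dimension is 1.\<close>

lemma irreducible_commutative_dim:
  assumes G: "group G" and irr: "irreducible_representation G n \<rho>"
    and comm: "\<And>g h. g \<in> carrier G \<Longrightarrow> h \<in> carrier G \<Longrightarrow> \<rho> g * \<rho> h = \<rho> h * \<rho> g"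
  shows "n = 1"
proof (rule ccontr)
  assume "n \<noteq> 1"
  note irrD = irreducible_representationD[OF irr]
  have n: "1 < n" using \<open>n \<noteq> 1\<close> irrD(2) by simp
  define W where "W = {v \<in> carrier_vec n. \<forall>i<n. i \<noteq> 0 \<longrightarrow> v $ i = (0::complex)}"
  have "VectorSpace.subspace class_ring W (module_vec TYPE(complex) n)"
    by (rule subspace_vecI) (auto simp: W_def)
  moreover have "\<rho> g *\<^sub>v w \<in> W" if "g \<in> carrier G" "w \<in> W" for g w
  proof -
    have "\<rho> g \<in> carrier_mat n n" by (rule representation_carrier[OF G irrD(1) that(1)])
    from schur[OF G irr this comm[OF _ that(1)]] obtain c where "\<rho> g = c \<cdot>\<^sub>m 1\<^sub>m n" by blast
    moreover have "(c \<cdot>\<^sub>m 1\<^sub>m n) *\<^sub>v w = c \<cdot>\<^sub>v w" using that(2)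
      by (intro eq_vecI) (auto simp: W_def)
    ultimately show ?thesis using that(2) by (auto simp: W_def)
  qed
  moreover have "unit_vec n 0 \<in> W" using n by (auto simp: W_def unit_vec_def)
  then have "W \<noteq> {0\<^sub>v n}" using n
    by (metis irrD(2) singletonD unit_vec_nonzero)
  ultimately have "W = carrier_vec n" using irrD(3)[of W] by blast
  moreover have "unit_vec n 1 \<notin> W" using n by (auto simp: W_def unit_vec_def)
  ultimately show False by auto
qed

section \<open>Block triangular form along an invariant subspace\<close>

text \<open>\<open>bs\<close> lists a maximal independent subset of \<open>W\<close>, and
  \<open>cs\<close> extends it to a maximal independent set of the whole space; the dimension bounds
  both searches. Lists fix the order in which the vectors become columns.\<close>

lemma (in vec_space) subspace_adapted_basis:
  assumes sub: "VectorSpace.subspace class_ring W V"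
  shows "\<exists>bs cs. set bs \<subseteq> W \<and> W \<subseteq> span (set bs) \<and> length (bs @ cs) = n \<and>
    set (bs @ cs) \<subseteq> carrier_vec n \<and> distinct (bs @ cs) \<and> lin_indpt (set (bs @ cs))"
proof -
  have subm: "submodule class_ring W V" using sub by (rule is_module)
  have Wc: "W \<subseteq> carrier_vec n" using submodule.subset[OF subm] by simp
  have "\<exists>B. finite B \<and> maximal B (\<lambda>S. S \<subseteq> W \<and> lin_indpt S)"
  proof (rule maximal_exists)
    fix A assume "A \<subseteq> W \<and> lin_indpt A"
    then have "lin_indpt A" "A \<subseteq> carrier_vec n" using Wc by auto
    then show "finite A \<and> card A \<le> n"
      using li_le_dim[of A] dim_is_n by simp
  next
    show "{} \<subseteq> W \<and> lin_indpt {}" by (simp add: lin_dep_def)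
  qed
  then obtain B where B: "finite B" "maximal B (\<lambda>S. S \<subseteq> W \<and> lin_indpt S)" by blast
  have BW: "B \<subseteq> W" and Bli: "lin_indpt B" using B(2) by (auto simp: maximal_def)
  have Bc: "B \<subseteq> carrier_vec n" using BW Wc by blast
  have Wspan: "W \<subseteq> span B"
  proof
    fix w assume w: "w \<in> W"
    show "w \<in> span B"
    proof (cases "w \<in> B")
      case True
      then show ?thesis using in_own_span[of B] Bc by auto
    next
      case False
      have "\<not> lin_indpt (B \<union> {w})"
        using B(2) w BW False unfolding maximal_def by blast
      then show ?thesis using lin_dep_iff_in_span[of B w] Bc Bli False w Wc by auto
    qed
  qed
  have "\<exists>D. finite D \<and> maximal D (\<lambda>S. S \<subseteq> carrier_vec n \<and> lin_indpt S \<and> B \<subseteq> S)"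
  proof (rule maximal_exists)
    fix A assume "A \<subseteq> carrier_vec n \<and> lin_indpt A \<and> B \<subseteq> A"
    then show "finite A \<and> card A \<le> n"
      using li_le_dim[of A] dim_is_n by simp
  next
    show "B \<subseteq> carrier_vec n \<and> lin_indpt B \<and> B \<subseteq> B" using Bc Bli by simp
  qed
  then obtain D where D: "finite D" "maximal D (\<lambda>S. S \<subseteq> carrier_vec n \<and> lin_indpt S \<and> B \<subseteq> S)" by blast
  have Dc: "D \<subseteq> carrier_vec n" and Dli: "lin_indpt D" and BD: "B \<subseteq> D"
    using D(2) by (auto simp: maximal_def)
  have "maximal D (\<lambda>S. S \<subseteq> carrier_vec n \<and> lin_indpt S)"
    using D(2) unfolding maximal_def by blast
  then have "basis D" by (rule max_li_is_basis)
  then have card: "card D = n" using dim_basis[OF D(1)] dim_is_n by simp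
  obtain bs where bs: "set bs = B" "distinct bs" using finite_distinct_list[OF B(1)] by blast
  obtain cs where cs: "set cs = D - B" "distinct cs" using finite_distinct_list[of "D - B"] D(1) by blast
  have D': "set (bs @ cs) = D" using bs cs BD by auto
  have dist: "distinct (bs @ cs)" using bs cs by auto
  show ?thesis
  proof (rule exI[of _ bs], rule exI[of _ cs], intro conjI)
    show "length (bs @ cs) = n" using distinct_card[OF dist] D' card by simp
    show "set (bs @ cs) \<subseteq> carrier_vec n" "lin_indpt (set (bs @ cs))"
      unfolding D' by (fact Dc, fact Dli)
    show "set bs \<subseteq> W" "W \<subseteq> span (set bs)" using BW Wspan bs by auto
  qed (fact dist)
qed

text \<open>\<open>P\<close> has the adapted basis as columns and \<open>Q\<close> is its inverse.
  The last two clauses say that \<open>W\<close> is described by the first \<open>r\<close>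
  coordinates, which is what makes conjugation by \<open>P\<close> produce a zero lower left
  block.\<close>

lemma subspace_adapted_matrix:
  assumes sub: "VectorSpace.subspace class_ring W (module_vec TYPE(complex) n)"
    and W0: "W \<noteq> {0\<^sub>v n}" and W1: "W \<noteq> carrier_vec n"
  shows "\<exists>r P Q. 0 < r \<and> r < n \<and> P \<in> carrier_mat n n \<and> Q \<in> carrier_mat n n \<and>
    P * Q = 1\<^sub>m n \<and> Q * P = 1\<^sub>m n \<and> (\<forall>j<r. col P j \<in> W) \<and>
    (\<forall>w\<in>W. \<forall>i<n. r \<le> i \<longrightarrow> (Q *\<^sub>v w) $ i = 0)"
proof -
  interpret vec_space "TYPE(complex)" n .
  have subm: "submodule class_ring W V" using sub by (rule is_module)
  have Wc: "W \<subseteq> carrier_vec n" using submodule.subset[OF subm] by simp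
  have W00: "0\<^sub>v n \<in> W" using submodule.zero_closed[OF subm] by simp
  obtain bs cs where bW: "set bs \<subseteq> W" and Wb: "W \<subseteq> span (set bs)" and len: "length (bs @ cs) = n"
    and car: "set (bs @ cs) \<subseteq> carrier_vec n" and dist: "distinct (bs @ cs)"
    and li: "lin_indpt (set (bs @ cs))"
    using subspace_adapted_basis[OF sub] by blast
  define r where "r = length bs"
  define P where "P = mat_of_cols n (bs @ cs)"
  have P: "P \<in> carrier_mat n n" unfolding P_def using len by auto
  have cols: "cols P = bs @ cs" unfolding P_def by (rule cols_mat_of_cols[OF car])
  have colP: "col P j = bs ! j" if "j < r" for j
  proof -
    have "(bs @ cs) ! j \<in> carrier_vec n"
      using car that nth_mem[of j "bs @ cs"] by (auto simp: r_def)
    then show ?thesis unfolding P_def using that by (subst col_mat_of_cols) (auto simp: r_def nth_append)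
  qed
  have "rank P = n" using lin_indpt_full_rank[OF P] cols dist li by simp
  then have "det P \<noteq> 0" using det_rank_iff[OF P] by simp
  from det_non_zero_imp_unit[OF P this, of "()"] obtain Q where
    Q: "Q \<in> carrier_mat n n" "P * Q = 1\<^sub>m n" "Q * P = 1\<^sub>m n"
    unfolding Units_def by (auto simp: ring_mat_simps)
  have bsc: "set bs \<subseteq> carrier_vec n" using car by auto
  then have bs_dim: "\<forall>w\<in>set bs. dim_vec w = n" by auto
  have Qw: "(Q *\<^sub>v w) $ i = 0" if w: "w \<in> W" and i: "r \<le> i" "i < n" for w i
  proof -
    have "w \<in> span_list bs" using w Wb span_list_as_span[OF bsc] by blast
    then obtain c where "w = lincomb_list c bs" by (rule in_span_listE)
    then have wc: "w = mat_of_cols n bs *\<^sub>v vec r c"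
      using lincomb_list_as_mat_mult[of bs c] bs_dim by (simp add: r_def)
    \<comment> \<open>The coefficients of \<open>w\<close> over \<open>bs\<close>, padded by zeros
      for the vectors of \<open>cs\<close>. Since \<open>w\<close> is \<open>P\<close> applied to
      \<open>y\<close>, applying \<open>Q\<close> returns \<open>y\<close>.\<close>
    define y where "y = vec n (\<lambda>i. if i < r then c i else 0)"
    have rn: "r \<le> n" using len by (simp add: r_def)
    have "w = P *\<^sub>v y"
    proof (rule eq_vecI)
      fix k assume "k < dim_vec (P *\<^sub>v y)"
      then have k: "k < n" using P by simp
      have "(P *\<^sub>v y) $ k = (\<Sum>j<n. P $$ (k,j) * (if j < r then c j else 0))"
        using P k by (auto simp: y_def scalar_prod_def atLeast0LessThan intro!: sum.cong)
      also have "\<dots> = (\<Sum>j<r. P $$ (k,j) * c j)"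
        by (rule sum.mono_neutral_cong_right) (use rn in auto)
      also have "\<dots> = (\<Sum>j<r. (bs ! j $ k) * c j)"
      proof (rule sum.cong)
        fix j assume "j \<in> {..<r}"
        then have j: "j < r" by simp
        have "P $$ (k,j) = col P j $ k" using P k j rn by simp
        then show "P $$ (k,j) * c j = (bs ! j $ k) * c j" using colP[OF j] by simp
      qed simp
      also have "\<dots> = w $ k"
        unfolding wc using k
        by (auto simp: scalar_prod_def atLeast0LessThan r_def mat_of_cols_def intro!: sum.cong)
      finally show "w $ k = (P *\<^sub>v y) $ k" by simp
    qed (use w Wc P in auto)
    then have "Q *\<^sub>v w = (Q * P) *\<^sub>v y"
      using Q P by (subst assoc_mult_mat_vec) (auto simp: y_def)
    also have "\<dots> = y" using Q(3) by (simp add: y_def)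
    finally show ?thesis using i by (simp add: y_def)
  qed
  have "r \<noteq> 0"
  proof
    assume "r = 0"
    then have "W \<subseteq> span {}" using Wb by (simp add: r_def)
    then have "W \<subseteq> {0\<^sub>v n}" using span_empty by simp
    then show False using W0 W00 by blast
  qed
  moreover have "r \<noteq> n"
  proof
    assume "r = n"
    then have cs: "cs = []" using len by (simp add: r_def)
    have "carrier_vec n \<subseteq> W"
    proof
      fix v :: "complex vec" assume v: "v \<in> carrier_vec n"
      have "v = (P * Q) *\<^sub>v v" using Q v by simp
      also have "\<dots> = P *\<^sub>v (Q *\<^sub>v v)" by (rule assoc_mult_mat_vec[OF P Q(1) v])
      also have "\<dots> = mat_of_cols n bs *\<^sub>v vec (length bs) (\<lambda>i. (Q *\<^sub>v v) $ i)"
      proof -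
        have "vec (length bs) (\<lambda>i. (Q *\<^sub>v v) $ i) = Q *\<^sub>v v"
          using \<open>r = n\<close> Q by (intro eq_vecI) (auto simp: r_def)
        then show ?thesis by (simp add: P_def cs)
      qed
      also have "\<dots> = lincomb_list (\<lambda>i. (Q *\<^sub>v v) $ i) bs"
        using lincomb_list_as_mat_mult[of bs "\<lambda>i. (Q *\<^sub>v v) $ i"] bs_dim by simp
      finally have "v \<in> span_list bs" by (auto simp: span_list_def)
      then have "v \<in> span (set bs)" using span_list_as_span[OF bsc] by blast
      then show "v \<in> W" using span_is_subset[OF bW subm] by blast
    qed
    then show False using W1 Wc by blast
  qed
  moreover have "r \<le> n" using len by (simp add: r_def)
  moreover have "col P j \<in> W" if "j < r" for j
    using colP[OF that] bW that by (auto simp: r_def)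
  ultimately show ?thesis using P Q Qw by (intro exI[of _ r] exI[of _ P] exI[of _ Q]) auto
qed

text \<open>The last clause replaces semisimplicity: a block triangular matrix of finite order with
  identity diagonal blocks is the identity in characteristic 0.\<close>

lemma composition_factors:
  assumes G: "group G" and fin: "finite (carrier G)"
  shows "representation G n \<rho> \<Longrightarrow> \<exists>xs.
    (\<forall>(m,\<sigma>)\<in>set xs. irreducible_representation G m \<sigma>) \<and>
    n = (\<Sum>(m,\<sigma>)\<leftarrow>xs. m) \<and>
    (\<forall>g\<in>carrier G. mat_trace (\<rho> g) = (\<Sum>(m,\<sigma>)\<leftarrow>xs. mat_trace (\<sigma> g))) \<and>
    (\<forall>g\<in>carrier G. (\<forall>(m,\<sigma>)\<in>set xs. \<sigma> g = 1\<^sub>m m) \<longrightarrow> \<rho> g = 1\<^sub>m n)"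
proof (induction n arbitrary: \<rho> rule: less_induct)
  case (less n)
  interpret group G by fact
  note \<rho> = less.prems
  show ?case
  \<comment> \<open>Irreducible representations have positive dimension, so dimension 0 needs the
    empty list.\<close>
  proof (cases "n = 0 \<or> irreducible_representation G n \<rho>")
    case True
    then show ?thesis
    proof
      assume "n = 0"
      then have "\<rho> g = 1\<^sub>m 0" if "g \<in> carrier G" for g
        using representation_carrier[OF G \<rho> that] by auto
      then show ?thesis using \<open>n = 0\<close> by (intro exI[of _ "[]"]) auto
    next
      assume "irreducible_representation G n \<rho>"
      then show ?thesis by (intro exI[of _ "[(n,\<rho>)]"]) auto
    qed
  next
    case False
    then obtain W where sub: "VectorSpace.subspace class_ring W (module_vec TYPE(complex) n)"
      and inv: "\<forall>g\<in>carrier G. \<forall>w\<in>W. \<rho> g *\<^sub>v w \<in> W" and W: "W \<noteq> {0\<^sub>v n}" "W \<noteq> carrier_vec n"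
      using \<rho> unfolding irreducible_representation_def by auto
    have Wc: "W \<subseteq> carrier_vec n"
      using submodule.subset[OF subspace.submod[OF sub]] by (simp add: module_vec_simps)
    obtain r P Q where r: "0 < r" "r < n" and P: "P \<in> carrier_mat n n" and Q: "Q \<in> carrier_mat n n"
      and PQ: "P * Q = 1\<^sub>m n" "Q * P = 1\<^sub>m n" and colP: "\<forall>j<r. col P j \<in> W"
      and Qw: "\<forall>w\<in>W. \<forall>i<n. r \<le> i \<longrightarrow> (Q *\<^sub>v w) $ i = 0"
      using subspace_adapted_matrix[OF sub W] by blast
    define s where "s = n - r"
    have s: "n = r + s" "s < n" using r by (auto simp: s_def)
    define T where "T g = Q * \<rho> g * P" for g
    have \<rho>c: "\<rho> g \<in> carrier_mat n n" if "g \<in> carrier G" for g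
      by (rule representation_carrier[OF G \<rho> that])
    have Tc: "T g \<in> carrier_mat n n" if "g \<in> carrier G" for g
      unfolding T_def using P Q \<rho>c[OF that] by auto
    have Tmult: "T (g \<otimes>\<^bsub>G\<^esub> h) = T g * T h" if "g \<in> carrier G" "h \<in> carrier G" for g h
    proof -
      have "T g * T h = Q * \<rho> g * (P * Q) * (\<rho> h * P)"
        unfolding T_def using P Q \<rho>c[OF that(1)] \<rho>c[OF that(2)] by (simp add: assoc_mult_mat[of _ n n _ n _ n])
      also have "\<dots> = Q * (\<rho> g * \<rho> h) * P"
        unfolding PQ using P Q \<rho>c[OF that(1)] \<rho>c[OF that(2)] by (simp add: assoc_mult_mat[of _ n n _ n _ n])
      finally show ?thesis unfolding T_def using representation_mult[OF G \<rho> that] by simp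
    qed
    have Tone: "T \<one>\<^bsub>G\<^esub> = 1\<^sub>m n"
      unfolding T_def using representation_one[OF G \<rho>] PQ Q P by simp
    \<comment> \<open>Column \<open>j\<close> of \<open>P\<close> lies in \<open>W\<close>,
      \<open>\<rho> g\<close> keeps it there, and \<open>Q\<close> sends vectors of \<open>W\<close>
      to vectors whose coordinates from \<open>r\<close> on vanish.\<close>
    have T0: "T g $$ (i,j) = 0" if "g \<in> carrier G" "r \<le> i" "i < n" "j < r" for g i j
    proof -
      have "T g $$ (i,j) = (Q * (\<rho> g * P)) $$ (i,j)"
        unfolding T_def using P Q \<rho>c[OF that(1)] by (simp add: assoc_mult_mat[of _ n n _ n _ n])
      also have "\<dots> = (Q *\<^sub>v col (\<rho> g * P) j) $ i"
        using P Q \<rho>c[OF that(1)] that r by simp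
      also have "col (\<rho> g * P) j = \<rho> g *\<^sub>v col P j"
        using P \<rho>c[OF that(1)] that r by (intro col_mult2[of _ n n _ n]) auto
      also have "(Q *\<^sub>v (\<rho> g *\<^sub>v col P j)) $ i = 0"
        using Qw inv colP that by blast
      finally show ?thesis .
    qed
    define A where "A g = mat r r (\<lambda>(i,j). T g $$ (i,j))" for g
    define B where "B g = mat r s (\<lambda>(i,j). T g $$ (i,j + r))" for g
    define D where "D g = mat s s (\<lambda>(i,j). T g $$ (i + r,j + r))" for g
    have c: "A g \<in> carrier_mat r r" "B g \<in> carrier_mat r s" "D g \<in> carrier_mat s s" for g
      by (auto simp: A_def B_def D_def)
    have Tblock: "T g = four_block_mat (A g) (B g) (0\<^sub>m s r) (D g)" if "g \<in> carrier G" for g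
    proof (rule eq_matI)
      fix i j assume "i < dim_row (four_block_mat (A g) (B g) (0\<^sub>m s r) (D g))"
        "j < dim_col (four_block_mat (A g) (B g) (0\<^sub>m s r) (D g))"
      then have "i < n" "j < n" using c[of g] s by auto
      then show "T g $$ (i,j) = four_block_mat (A g) (B g) (0\<^sub>m s r) (D g) $$ (i,j)"
        using c[of g] s T0[OF that, of i j] by (auto simp: A_def B_def D_def)
    qed (use Tc[OF that] c[of g] s in auto)
    have block: "A (g \<otimes>\<^bsub>G\<^esub> h) = A g * A h \<and> B (g \<otimes>\<^bsub>G\<^esub> h) = A g * B h + B g * D h \<and> D (g \<otimes>\<^bsub>G\<^esub> h) = D g * D h"
      if gh: "g \<in> carrier G" "h \<in> carrier G" for g h
    proof -
      have "T g * T h = four_block_mat (A g * A h) (A g * B h + B g * D h) (0\<^sub>m s r) (D g * D h)"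
        unfolding Tblock[OF gh(1)] Tblock[OF gh(2)]
        using c[of g] c[of h]
        by (subst mult_four_block_mat[of _ r r _ s _ s _ _ r _ s]) auto
      then have e: "T (g \<otimes>\<^bsub>G\<^esub> h) = four_block_mat (A g * A h) (A g * B h + B g * D h) (0\<^sub>m s r) (D g * D h)"
        using Tmult[OF gh] by simp
      have AA: "A g * A h \<in> carrier_mat r r" "A g * B h + B g * D h \<in> carrier_mat r s" "D g * D h \<in> carrier_mat s s"
        using c[of g] c[of h] by auto
      show ?thesis
        using e AA c[of "g \<otimes>\<^bsub>G\<^esub> h"] four_block_mat_inject[OF c(1) c(2) _ c(3) AA(1,2) _ AA(3)]
        unfolding Tblock[OF m_closed[OF gh]] by simp
    qed
    have ones: "A \<one>\<^bsub>G\<^esub> = 1\<^sub>m r" "B \<one>\<^bsub>G\<^esub> = 0\<^sub>m r s" "D \<one>\<^bsub>G\<^esub> = 1\<^sub>m s"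
      using Tone four_block_mat_inject[OF c(1) c(2) zero_carrier_mat c(3) one_carrier_mat zero_carrier_mat zero_carrier_mat one_carrier_mat]
      unfolding Tblock[OF one_closed] s(1) four_block_one_mat[symmetric] by blast+
    have repA: "representation G r A"
      unfolding representation_iff[OF G] using c block ones by blast
    have repD: "representation G s D"
      unfolding representation_iff[OF G] using c block ones by blast
    have trace: "mat_trace (\<rho> g) = mat_trace (A g) + mat_trace (D g)" if "g \<in> carrier G" for g
    proof -
      have "mat_trace (T g) = mat_trace (P * (Q * \<rho> g))"
        unfolding T_def using P Q \<rho>c[OF that] by (intro mat_trace_mult_comm[of _ n n]) auto
      also have "P * (Q * \<rho> g) = (P * Q) * \<rho> g"
        using P Q \<rho>c[OF that] by (intro assoc_mult_mat[symmetric]) auto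
      also have "\<dots> = \<rho> g" using PQ \<rho>c[OF that] by simp
      finally show ?thesis using mat_trace_four_block[OF c(1) c(3)] Tblock[OF that] by simp
    qed
    have one: "\<rho> g = 1\<^sub>m n" if g: "g \<in> carrier G" and Ag: "A g = 1\<^sub>m r" and Dg: "D g = 1\<^sub>m s" for g
    proof -
      \<comment> \<open>With identity diagonal blocks the product rule for \<open>B\<close> becomes
        additive on powers of \<open>g\<close>. At the exponent |G| the power is the identity, so
        |G| times \<open>B g\<close> is zero.\<close>
      have pow: "A (g [^]\<^bsub>G\<^esub> k) = 1\<^sub>m r \<and> D (g [^]\<^bsub>G\<^esub> k) = 1\<^sub>m s \<and> B (g [^]\<^bsub>G\<^esub> k) = of_nat k \<cdot>\<^sub>m B g" for k :: nat
      proof (induction k)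
        case 0
        then show ?case using ones c(2)[of g] by (auto intro!: eq_matI)
      next
        case (Suc k)
        have "B (g [^]\<^bsub>G\<^esub> Suc k) = B g + of_nat k \<cdot>\<^sub>m B g"
          using block[of "g [^]\<^bsub>G\<^esub> k" g] g Suc c[of g] Dg by (simp add: smult_carrier_mat[OF c(2)])
        also have "\<dots> = of_nat (Suc k) \<cdot>\<^sub>m B g"
          using c(2)[of g] by (intro eq_matI) (auto simp: algebra_simps)
        finally show ?case using block[of "g [^]\<^bsub>G\<^esub> k" g] g Suc Ag Dg by simp
      qed
      have "0 < Coset.order G" using fin order_gt_0_iff_finite by blast
      have "B g = 0\<^sub>m r s"
      proof (rule eq_matI)
        fix i j assume "i < dim_row (0\<^sub>m r s :: complex mat)" "j < dim_col (0\<^sub>m r s :: complex mat)"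
        then have ij: "i < r" "j < s" by auto
        have "of_nat (Coset.order G) \<cdot>\<^sub>m B g = 0\<^sub>m r s"
          using pow[of "Coset.order G"] pow_order_eq_1[OF g] ones by simp
        then have "(of_nat (Coset.order G) \<cdot>\<^sub>m B g) $$ (i,j) = 0" using ij by simp
        then have "of_nat (Coset.order G) * B g $$ (i,j) = 0" using ij c(2)[of g] by auto
        then show "B g $$ (i,j) = 0\<^sub>m r s $$ (i,j)" using \<open>0 < Coset.order G\<close> ij by simp
      qed (use c(2)[of g] in auto)
      then have "T g = 1\<^sub>m n" using Tblock[OF g] Ag Dg s by simp
      then have "P * T g * Q = 1\<^sub>m n" using P PQ by simp
      moreover have "P * T g * Q = (P * Q) * \<rho> g * (P * Q)"
        unfolding T_def using P Q \<rho>c[OF g] by (simp add: assoc_mult_mat[of _ n n _ n _ n])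
      ultimately show ?thesis using PQ \<rho>c[OF g] by simp
    qed
    obtain xs where xs: "\<forall>(m,\<sigma>)\<in>set xs. irreducible_representation G m \<sigma>" "r = (\<Sum>(m,\<sigma>)\<leftarrow>xs. m)"
      "\<forall>g\<in>carrier G. mat_trace (A g) = (\<Sum>(m,\<sigma>)\<leftarrow>xs. mat_trace (\<sigma> g))"
      "\<forall>g\<in>carrier G. (\<forall>(m,\<sigma>)\<in>set xs. \<sigma> g = 1\<^sub>m m) \<longrightarrow> A g = 1\<^sub>m r"
      using less.IH[OF r(2) repA] by blast
    obtain ys where ys: "\<forall>(m,\<sigma>)\<in>set ys. irreducible_representation G m \<sigma>" "s = (\<Sum>(m,\<sigma>)\<leftarrow>ys. m)"
      "\<forall>g\<in>carrier G. mat_trace (D g) = (\<Sum>(m,\<sigma>)\<leftarrow>ys. mat_trace (\<sigma> g))"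
      "\<forall>g\<in>carrier G. (\<forall>(m,\<sigma>)\<in>set ys. \<sigma> g = 1\<^sub>m m) \<longrightarrow> D g = 1\<^sub>m s"
      using less.IH[OF s(2) repD] by blast
    show ?thesis
    proof (rule exI[of _ "xs @ ys"], intro conjI)
      show "n = (\<Sum>(m,\<sigma>)\<leftarrow>xs @ ys. m)" using xs(2) ys(2) s(1) by simp
      show "\<forall>g\<in>carrier G. mat_trace (\<rho> g) = (\<Sum>(m,\<sigma>)\<leftarrow>xs @ ys. mat_trace (\<sigma> g))"
        using trace xs(3) ys(3) by simp
      show "\<forall>g\<in>carrier G. (\<forall>(m,\<sigma>)\<in>set (xs @ ys). \<sigma> g = 1\<^sub>m m) \<longrightarrow> \<rho> g = 1\<^sub>m n"
      proof (intro ballI impI)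
        fix g assume g: "g \<in> carrier G" and "\<forall>(m,\<sigma>)\<in>set (xs @ ys). \<sigma> g = 1\<^sub>m m"
        then have "A g = 1\<^sub>m r" "D g = 1\<^sub>m s" using xs(4) ys(4) by auto
        then show "\<rho> g = 1\<^sub>m n" by (rule one[OF g])
      qed
      show "\<forall>(m,\<sigma>)\<in>set (xs @ ys). irreducible_representation G m \<sigma>" using xs(1) ys(1) by auto
    qed
  qed
qed

section \<open>Character orthogonality and VZ-groups\<close>

text \<open>The size is an explicit parameter because matrices of all sizes share one type, so an
  empty sum would have no size of its own. Working entrywise reduces everything to finite sums of
  complex numbers.\<close>

definition mat_sum :: "nat \<Rightarrow> ('i \<Rightarrow> complex mat) \<Rightarrow> 'i set \<Rightarrow> complex mat" where
  "mat_sum n f S = mat n n (\<lambda>(i,j). \<Sum>s\<in>S. f s $$ (i,j))"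

lemma mat_sum_carrier [simp]: "mat_sum n f S \<in> carrier_mat n n"
  by (simp add: mat_sum_def)

lemma mat_sum_index: "i < n \<Longrightarrow> j < n \<Longrightarrow> mat_sum n f S $$ (i,j) = (\<Sum>s\<in>S. f s $$ (i,j))"
  by (simp add: mat_sum_def)

lemma square_mat_mult_index:
  assumes "A \<in> carrier_mat n n" "B \<in> carrier_mat n n" "i < n" "j < n"
  shows "(A * B) $$ (i,j) = (\<Sum>k<n. A $$ (i,k) * B $$ (k,j))"
  using assms by (auto simp: scalar_prod_def atLeast0LessThan intro!: sum.cong)

lemma mult_mat_sum:
  assumes A: "A \<in> carrier_mat n n" and f: "\<And>s. s \<in> S \<Longrightarrow> f s \<in> carrier_mat n n"
  shows "A * mat_sum n f S = mat_sum n (\<lambda>s. A * f s) S"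
    and "mat_sum n f S * A = mat_sum n (\<lambda>s. f s * A) S"
proof -
  show "A * mat_sum n f S = mat_sum n (\<lambda>s. A * f s) S"
  proof (rule eq_matI)
    fix i j assume "i < dim_row (mat_sum n (\<lambda>s. A * f s) S)" "j < dim_col (mat_sum n (\<lambda>s. A * f s) S)"
    then have ij: "i < n" "j < n" by (auto simp: mat_sum_def)
    have "(A * mat_sum n f S) $$ (i,j) = (\<Sum>k<n. A $$ (i,k) * (\<Sum>s\<in>S. f s $$ (k,j)))"
      using A ij by (auto simp: mat_sum_def scalar_prod_def atLeast0LessThan intro!: sum.cong)
    also have "\<dots> = (\<Sum>s\<in>S. \<Sum>k<n. A $$ (i,k) * f s $$ (k,j))"
      by (subst sum.swap) (simp add: sum_distrib_left)
    also have "\<dots> = (\<Sum>s\<in>S. (A * f s) $$ (i,j))"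
    proof (rule sum.cong)
      fix s assume "s \<in> S"
      then show "(\<Sum>k<n. A $$ (i,k) * f s $$ (k,j)) = (A * f s) $$ (i,j)"
        using A f[of s] ij by (auto simp: scalar_prod_def atLeast0LessThan intro!: sum.cong)
    qed simp
    finally show "(A * mat_sum n f S) $$ (i,j) = mat_sum n (\<lambda>s. A * f s) S $$ (i,j)"
      using ij by (simp add: mat_sum_index)
  qed (use A in \<open>auto simp: mat_sum_def\<close>)
  show "mat_sum n f S * A = mat_sum n (\<lambda>s. f s * A) S"
  proof (rule eq_matI)
    fix i j assume "i < dim_row (mat_sum n (\<lambda>s. f s * A) S)" "j < dim_col (mat_sum n (\<lambda>s. f s * A) S)"
    then have ij: "i < n" "j < n" by (auto simp: mat_sum_def)
    have "(mat_sum n f S * A) $$ (i,j) = (\<Sum>k<n. (\<Sum>s\<in>S. f s $$ (i,k)) * A $$ (k,j))"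
      using A ij by (auto simp: mat_sum_def scalar_prod_def atLeast0LessThan intro!: sum.cong)
    also have "\<dots> = (\<Sum>s\<in>S. \<Sum>k<n. f s $$ (i,k) * A $$ (k,j))"
      by (subst sum.swap) (simp add: sum_distrib_right)
    also have "\<dots> = (\<Sum>s\<in>S. (f s * A) $$ (i,j))"
    proof (rule sum.cong)
      fix s assume "s \<in> S"
      then show "(\<Sum>k<n. f s $$ (i,k) * A $$ (k,j)) = (f s * A) $$ (i,j)"
        using A f[of s] ij by (auto simp: scalar_prod_def atLeast0LessThan intro!: sum.cong)
    qed simp
    finally show "(mat_sum n f S * A) $$ (i,j) = mat_sum n (\<lambda>s. f s * A) S $$ (i,j)"
      using ij by (simp add: mat_sum_index)
  qed (use A in \<open>auto simp: mat_sum_def\<close>)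
qed

lemma mat_trace_mat_sum:
  assumes "\<And>s. s \<in> S \<Longrightarrow> f s \<in> carrier_mat n n"
  shows "mat_trace (mat_sum n f S) = (\<Sum>s\<in>S. mat_trace (f s))"
proof -
  have "mat_trace (mat_sum n f S) = (\<Sum>i<n. \<Sum>s\<in>S. f s $$ (i,i))"
    by (simp add: mat_trace_def mat_sum_def)
  also have "\<dots> = (\<Sum>s\<in>S. \<Sum>i<n. f s $$ (i,i))" by (rule sum.swap)
  also have "\<dots> = (\<Sum>s\<in>S. mat_trace (f s))"
    using assms by (auto simp: mat_trace_def intro!: sum.cong)
  finally show ?thesis .
qed

lemma mat_sum_reindex:
  assumes "\<And>s. s \<in> S \<Longrightarrow> f (b s) = f' s" "bij_betw b S T"
  shows "mat_sum n f' S = mat_sum n f T"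
proof -
  have "(\<Sum>s\<in>S. f' s $$ (i,j)) = (\<Sum>t\<in>T. f t $$ (i,j))" for i j
    using sum.reindex_bij_betw[OF assms(2), of "\<lambda>t. f t $$ (i,j)"] assms(1) by simp
  then show ?thesis by (simp add: mat_sum_def)
qed

lemma (in group) bij_betw_mult_left: "h \<in> carrier G \<Longrightarrow> bij_betw (\<lambda>g. h \<otimes> g) (carrier G) (carrier G)"
  by (rule bij_betw_byWitness[of _ "\<lambda>g. inv h \<otimes> g"]) (auto simp: m_assoc[symmetric])

text \<open>Replacing g by hg in the sum shows that the average commutes with every
  \<open>\<rho> h\<close>; Schur's lemma then applies.\<close>

lemma averaged_conjugate_scalar:
  assumes G: "group G" and fin: "finite (carrier G)" and irr: "irreducible_representation G n \<rho>"
    and X: "X \<in> carrier_mat n n"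
  shows "\<exists>c. mat_sum n (\<lambda>g. \<rho> g * X * \<rho> (inv\<^bsub>G\<^esub> g)) (carrier G) = c \<cdot>\<^sub>m 1\<^sub>m n"
proof (rule schur[OF G irr])
  interpret group G by fact
  note \<rho> = irreducible_representationD(1)[OF irr]
  have c: "\<rho> g \<in> carrier_mat n n" if "g \<in> carrier G" for g by (rule representation_carrier[OF G \<rho> that])
  have m: "\<rho> (g \<otimes>\<^bsub>G\<^esub> h) = \<rho> g * \<rho> h" if "g \<in> carrier G" "h \<in> carrier G" for g h
    by (rule representation_mult[OF G \<rho> that])
  fix h assume h: "h \<in> carrier G"
  have fc: "\<rho> g * X * \<rho> (inv\<^bsub>G\<^esub> g) \<in> carrier_mat n n" if "g \<in> carrier G" for g
    using c[OF that] c[OF inv_closed[OF that]] X by auto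
  have "\<rho> h * mat_sum n (\<lambda>g. \<rho> g * X * \<rho> (inv\<^bsub>G\<^esub> g)) (carrier G)
      = mat_sum n (\<lambda>g. \<rho> h * (\<rho> g * X * \<rho> (inv\<^bsub>G\<^esub> g))) (carrier G)"
    by (rule mult_mat_sum(1)[OF c[OF h] fc])
  also have "\<dots> = mat_sum n (\<lambda>g. \<rho> g * X * \<rho> (inv\<^bsub>G\<^esub> g) * \<rho> h) (carrier G)"
  proof (rule mat_sum_reindex[OF _ bij_betw_mult_left[OF h]])
    fix g assume g: "g \<in> carrier G"
    have "\<rho> (inv\<^bsub>G\<^esub> (h \<otimes>\<^bsub>G\<^esub> g)) * \<rho> h = \<rho> (inv\<^bsub>G\<^esub> (h \<otimes>\<^bsub>G\<^esub> g) \<otimes>\<^bsub>G\<^esub> h)"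
      using m[of "inv\<^bsub>G\<^esub> (h \<otimes>\<^bsub>G\<^esub> g)" h] g h by simp
    also have "inv\<^bsub>G\<^esub> (h \<otimes>\<^bsub>G\<^esub> g) \<otimes>\<^bsub>G\<^esub> h = inv\<^bsub>G\<^esub> g" using g h by (simp add: inv_mult_group m_assoc)
    finally have e: "\<rho> (inv\<^bsub>G\<^esub> (h \<otimes>\<^bsub>G\<^esub> g)) * \<rho> h = \<rho> (inv\<^bsub>G\<^esub> g)" .
    have "\<rho> (h \<otimes>\<^bsub>G\<^esub> g) * X * \<rho> (inv\<^bsub>G\<^esub> (h \<otimes>\<^bsub>G\<^esub> g)) * \<rho> h
       = \<rho> (h \<otimes>\<^bsub>G\<^esub> g) * X * (\<rho> (inv\<^bsub>G\<^esub> (h \<otimes>\<^bsub>G\<^esub> g)) * \<rho> h)"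
      using c[of "h \<otimes>\<^bsub>G\<^esub> g"] c[of "inv\<^bsub>G\<^esub> (h \<otimes>\<^bsub>G\<^esub> g)"] c[OF h] X g h
      by (intro assoc_mult_mat[of _ n n _ n _ n]) auto
    also have "\<dots> = \<rho> h * \<rho> g * X * \<rho> (inv\<^bsub>G\<^esub> g)" unfolding e m[OF h g] ..
    also have "\<dots> = \<rho> h * (\<rho> g * X * \<rho> (inv\<^bsub>G\<^esub> g))"
      using c[OF g] c[OF inv_closed[OF g]] c[OF h] X by (simp add: assoc_mult_mat[of _ n n _ n _ n])
    finally show "\<rho> (h \<otimes>\<^bsub>G\<^esub> g) * X * \<rho> (inv\<^bsub>G\<^esub> (h \<otimes>\<^bsub>G\<^esub> g)) * \<rho> h = \<rho> h * (\<rho> g * X * \<rho> (inv\<^bsub>G\<^esub> g))" .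
  qed
  also have "\<dots> = mat_sum n (\<lambda>g. \<rho> g * X * \<rho> (inv\<^bsub>G\<^esub> g)) (carrier G) * \<rho> h"
    by (rule mult_mat_sum(2)[OF c[OF h] fc, symmetric])
  finally show "\<rho> h * mat_sum n (\<lambda>g. \<rho> g * X * \<rho> (inv\<^bsub>G\<^esub> g)) (carrier G)
      = mat_sum n (\<lambda>g. \<rho> g * X * \<rho> (inv\<^bsub>G\<^esub> g)) (carrier G) * \<rho> h" .
qed simp

text \<open>Average the matrix unit at position (a,b): entry (a,b) of the result is the sum in
  question, and the average is a scalar matrix. Conjugation preserves the trace, so the scalar times
  n equals |G| times the trace of the matrix unit. Diagonal coefficients suffice, as only traces are
  multiplied later.\<close>

lemma schur_orthogonality:
  assumes G: "group G" and fin: "finite (carrier G)" and irr: "irreducible_representation G n \<rho>"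
    and a: "a < n" and b: "b < n"
  shows "(\<Sum>g\<in>carrier G. \<rho> g $$ (a,a) * \<rho> (inv\<^bsub>G\<^esub> g) $$ (b,b)) =
    (if a = b then of_nat (Coset.order G) / of_nat n else 0)"
proof -
  interpret group G by fact
  note \<rho> = irreducible_representationD(1)[OF irr] and n = irreducible_representationD(2)[OF irr]
  have c: "\<rho> g \<in> carrier_mat n n" if "g \<in> carrier G" for g by (rule representation_carrier[OF G \<rho> that])
  define X where "X = mat n n (\<lambda>(i,j). if i = a \<and> j = b then 1 else 0 :: complex)"
  have X: "X \<in> carrier_mat n n" by (simp add: X_def)
  have fc: "\<rho> g * X * \<rho> (inv\<^bsub>G\<^esub> g) \<in> carrier_mat n n" if "g \<in> carrier G" for g
    using c[OF that] c[OF inv_closed[OF that]] X by auto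
  have entry: "(\<rho> g * X * \<rho> (inv\<^bsub>G\<^esub> g)) $$ (a,b) = \<rho> g $$ (a,a) * \<rho> (inv\<^bsub>G\<^esub> g) $$ (b,b)"
    if g: "g \<in> carrier G" for g
  proof -
    have e: "(\<rho> g * X) $$ (a,j) = (if j = b then \<rho> g $$ (a,a) else 0)" if "j < n" for j
    proof -
      have "(\<rho> g * X) $$ (a,j) = (\<Sum>k<n. \<rho> g $$ (a,k) * (if k = a \<and> j = b then 1 else 0))"
        using c[OF g] a that by (auto simp: X_def scalar_prod_def atLeast0LessThan intro!: sum.cong)
      also have "\<dots> = (\<Sum>k<n. if k = a then (if j = b then \<rho> g $$ (a,a) else 0) else 0)"
        by (rule sum.cong) auto
      finally show ?thesis using a by simp
    qed
    have "(\<rho> g * X * \<rho> (inv\<^bsub>G\<^esub> g)) $$ (a,b) = (\<Sum>j<n. (\<rho> g * X) $$ (a,j) * \<rho> (inv\<^bsub>G\<^esub> g) $$ (j,b))"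
      using c[OF g] c[OF inv_closed[OF g]] X a b by (intro square_mat_mult_index) auto
    also have "\<dots> = (\<Sum>j<n. if j = b then \<rho> g $$ (a,a) * \<rho> (inv\<^bsub>G\<^esub> g) $$ (b,b) else 0)"
      by (rule sum.cong) (auto simp: e)
    finally show ?thesis using b by simp
  qed
  obtain d where d: "mat_sum n (\<lambda>g. \<rho> g * X * \<rho> (inv\<^bsub>G\<^esub> g)) (carrier G) = d \<cdot>\<^sub>m 1\<^sub>m n"
    using averaged_conjugate_scalar[OF G fin irr X] by blast
  have "(\<Sum>g\<in>carrier G. \<rho> g $$ (a,a) * \<rho> (inv\<^bsub>G\<^esub> g) $$ (b,b)) = (d \<cdot>\<^sub>m 1\<^sub>m n) $$ (a,b)"
    unfolding d[symmetric] using a b by (simp add: mat_sum_index entry)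
  also have "\<dots> = (if a = b then d else 0)" using a b by simp
  finally have sum: "(\<Sum>g\<in>carrier G. \<rho> g $$ (a,a) * \<rho> (inv\<^bsub>G\<^esub> g) $$ (b,b)) = (if a = b then d else 0)" .
  have trX: "mat_trace X = (if a = b then 1 else 0)"
  proof -
    have "mat_trace X = (\<Sum>i<n. if i = a then (if a = b then 1 else 0) else 0)"
      unfolding mat_trace_def X_def by (auto intro!: sum.cong)
    then show ?thesis using a by simp
  qed
  have "d * of_nat n = mat_trace (d \<cdot>\<^sub>m 1\<^sub>m n)" by (simp add: mat_trace_smult[of _ n])
  also have "\<dots> = (\<Sum>g\<in>carrier G. mat_trace (\<rho> g * X * \<rho> (inv\<^bsub>G\<^esub> g)))"
    unfolding d[symmetric] by (rule mat_trace_mat_sum[OF fc])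
  also have "\<dots> = (\<Sum>g\<in>carrier G. mat_trace X)"
  proof (rule sum.cong)
    fix g assume g: "g \<in> carrier G"
    have "mat_trace (\<rho> g * X * \<rho> (inv\<^bsub>G\<^esub> g)) = mat_trace (\<rho> (inv\<^bsub>G\<^esub> g) * (\<rho> g * X))"
      using c[OF g] c[OF inv_closed[OF g]] X by (intro mat_trace_mult_comm[of _ n n]) auto
    also have "\<rho> (inv\<^bsub>G\<^esub> g) * (\<rho> g * X) = (\<rho> (inv\<^bsub>G\<^esub> g) * \<rho> g) * X"
      using c[OF g] c[OF inv_closed[OF g]] X by (intro assoc_mult_mat[symmetric]) auto
    also have "\<dots> = X" using representation_inv(2)[OF G \<rho> g] X by simp
    finally show "mat_trace (\<rho> g * X * \<rho> (inv\<^bsub>G\<^esub> g)) = mat_trace X" .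
  qed simp
  finally have "d * of_nat n = of_nat (Coset.order G) * (if a = b then 1 else 0)"
    by (simp add: trX Coset.order_def)
  then show ?thesis using sum n by (auto simp: field_simps)
qed

text \<open>Expanding both traces leaves only the n pairs a = b, each contributing |G|/n. Evaluating
  the second trace at the inverse, in place of complex conjugation, avoids any appeal to
  unitarity.\<close>

lemma irreducible_character_norm:
  assumes G: "group G" and fin: "finite (carrier G)" and irr: "irreducible_representation G n \<rho>"
  shows "(\<Sum>g\<in>carrier G. mat_trace (\<rho> g) * mat_trace (\<rho> (inv\<^bsub>G\<^esub> g))) = of_nat (Coset.order G)"
proof -
  interpret group G by fact
  note \<rho> = irreducible_representationD(1)[OF irr] and n = irreducible_representationD(2)[OF irr]
  have tr: "mat_trace (\<rho> g) = (\<Sum>a<n. \<rho> g $$ (a,a))" if "g \<in> carrier G" for g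
    using representation_carrier[OF G \<rho> that] by (simp add: mat_trace_def)
  have "(\<Sum>g\<in>carrier G. mat_trace (\<rho> g) * mat_trace (\<rho> (inv\<^bsub>G\<^esub> g)))
      = (\<Sum>g\<in>carrier G. \<Sum>a<n. \<Sum>b<n. \<rho> g $$ (a,a) * \<rho> (inv\<^bsub>G\<^esub> g) $$ (b,b))"
    by (rule sum.cong) (simp_all add: tr sum_product)
  also have "\<dots> = (\<Sum>a<n. \<Sum>g\<in>carrier G. \<Sum>b<n. \<rho> g $$ (a,a) * \<rho> (inv\<^bsub>G\<^esub> g) $$ (b,b))"
    by (rule sum.swap)
  also have "\<dots> = (\<Sum>a<n. \<Sum>b<n. \<Sum>g\<in>carrier G. \<rho> g $$ (a,a) * \<rho> (inv\<^bsub>G\<^esub> g) $$ (b,b))"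
    by (rule sum.cong) (simp_all add: sum.swap[of _ "carrier G"])
  also have "\<dots> = (\<Sum>a<n. \<Sum>b<n. if a = b then of_nat (Coset.order G) / of_nat n else 0)"
    by (intro sum.cong) (simp_all add: schur_orthogonality[OF G fin irr])
  also have "\<dots> = of_nat (Coset.order G)" using n by simp
  finally show ?thesis .
qed

text \<open>The sum \<open>M\<close> of all \<open>\<rho> g\<close> absorbs every
  \<open>\<rho> h\<close> on either side, so by Schur it is d times the identity. If d were nonzero,
  absorption would make every \<open>\<rho> h\<close> the identity, and irreducibility would force
  dimension 1.\<close>

lemma irreducible_trace_sum_zero:
  assumes G: "group G" and fin: "finite (carrier G)" and irr: "irreducible_representation G n \<rho>"
    and n: "n \<noteq> 1"
  shows "(\<Sum>g\<in>carrier G. mat_trace (\<rho> g)) = 0"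
proof (rule ccontr)
  assume nz: "(\<Sum>g\<in>carrier G. mat_trace (\<rho> g)) \<noteq> 0"
  interpret group G by fact
  note \<rho> = irreducible_representationD(1)[OF irr]
  have c: "\<rho> g \<in> carrier_mat n n" if "g \<in> carrier G" for g by (rule representation_carrier[OF G \<rho> that])
  define M where "M = mat_sum n \<rho> (carrier G)"
  have M: "M \<in> carrier_mat n n" by (simp add: M_def)
  have left: "\<rho> h * M = M" if h: "h \<in> carrier G" for h
  proof -
    have "\<rho> h * M = mat_sum n (\<lambda>g. \<rho> h * \<rho> g) (carrier G)"
      unfolding M_def by (rule mult_mat_sum(1)[OF c[OF h] c])
    also have "\<dots> = M"
      unfolding M_def by (rule mat_sum_reindex[OF _ bij_betw_mult_left[OF h]]) (rule representation_mult[OF G \<rho> h])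
    finally show ?thesis .
  qed
  have bij: "bij_betw (\<lambda>g. g \<otimes>\<^bsub>G\<^esub> h) (carrier G) (carrier G)" if "h \<in> carrier G" for h
    by (rule bij_betw_byWitness[of _ "\<lambda>g. g \<otimes>\<^bsub>G\<^esub> inv\<^bsub>G\<^esub> h"]) (use that in \<open>auto simp: m_assoc\<close>)
  have right: "M * \<rho> h = M" if h: "h \<in> carrier G" for h
  proof -
    have "M * \<rho> h = mat_sum n (\<lambda>g. \<rho> g * \<rho> h) (carrier G)"
      unfolding M_def by (rule mult_mat_sum(2)[OF c[OF h] c])
    also have "\<dots> = M"
      unfolding M_def by (rule mat_sum_reindex[OF _ bij[OF h]]) (rule representation_mult[OF G \<rho> _ h])
    finally show ?thesis .
  qed
  obtain d where d: "M = d \<cdot>\<^sub>m 1\<^sub>m n" using schur[OF G irr M] left right by metis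
  have "mat_trace M \<noteq> 0" using nz mat_trace_mat_sum[of "carrier G" \<rho> n] c by (simp add: M_def)
  then have "d \<noteq> 0" unfolding d by (auto simp: mat_trace_smult[of _ n])
  have one: "\<rho> h = 1\<^sub>m n" if h: "h \<in> carrier G" for h
  proof -
    have "d \<cdot>\<^sub>m \<rho> h = d \<cdot>\<^sub>m 1\<^sub>m n" using left[OF h] c[OF h] mult_smult_distrib[OF c[OF h] one_carrier_mat, of d] unfolding d by simp
    then have "(1/d) \<cdot>\<^sub>m (d \<cdot>\<^sub>m \<rho> h) = (1/d) \<cdot>\<^sub>m (d \<cdot>\<^sub>m 1\<^sub>m n)" by simp
    moreover have "(1/d) \<cdot>\<^sub>m (d \<cdot>\<^sub>m A) = A" for A :: "complex mat"
      using \<open>d \<noteq> 0\<close> by (intro eq_matI) auto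
    ultimately show ?thesis by simp
  qed
  have "n = 1" by (rule irreducible_commutative_dim[OF G irr]) (simp add: one)
  then show False using n by simp
qed

section \<open>The regular representation and the detection of group elements\<close>

text \<open>Left translations written as permutation matrices along an enumeration \<open>e\<close>
  of the group. A translation by a nonidentity element fixes nothing, so its diagonal is zero; this
  gives both the trace and the triviality of the kernel.\<close>

lemma regular_representation:
  assumes G: "group G" and fin: "finite (carrier G)"
  shows "\<exists>\<rho>. representation G (Coset.order G) \<rho> \<and>
    (\<forall>g\<in>carrier G. \<rho> g = 1\<^sub>m (Coset.order G) \<longrightarrow> g = \<one>\<^bsub>G\<^esub>) \<and>
    (\<forall>g\<in>carrier G. g \<noteq> \<one>\<^bsub>G\<^esub> \<longrightarrow> mat_trace (\<rho> g) = 0)"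
proof -
  interpret group G by fact
  define N where "N = Coset.order G"
  obtain e where "bij_betw e {0..<card (carrier G)} (carrier G)" using ex_bij_betw_nat_finite[OF fin] by blast
  then have e: "bij_betw e {..<N} (carrier G)" by (simp add: N_def Coset.order_def atLeast0LessThan)
  have ec: "e i \<in> carrier G" if "i < N" for i using e that by (auto simp: bij_betw_def)
  have einj: "e i = e j \<longleftrightarrow> i = j" if "i < N" "j < N" for i j
    using e that by (auto simp: bij_betw_def inj_on_def)
  have N0: "0 < N" using order_gt_0_iff_finite fin by (simp add: N_def)
  define R where "R g = mat N N (\<lambda>(i,j). if e i = g \<otimes>\<^bsub>G\<^esub> e j then 1 else 0 :: complex)" for g
  have rep: "representation G N R"
    unfolding representation_iff[OF G]
  proof (intro conjI ballI)
    show "R g \<in> carrier_mat N N" for g by (simp add: R_def)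
    show "R \<one>\<^bsub>G\<^esub> = 1\<^sub>m N"
      by (rule eq_matI) (auto simp: R_def ec einj)
    fix g h assume gh: "g \<in> carrier G" "h \<in> carrier G"
    show "R (g \<otimes>\<^bsub>G\<^esub> h) = R g * R h"
    proof (rule eq_matI)
      fix i j assume "i < dim_row (R g * R h)" "j < dim_col (R g * R h)"
      then have ij: "i < N" "j < N" by (auto simp: R_def)
      have "h \<otimes>\<^bsub>G\<^esub> e j \<in> carrier G" using gh ec ij by simp
      \<comment> \<open>The index to which \<open>h\<close> moves \<open>j\<close>; it is the only
        one that contributes to the matrix product below.\<close>
      then obtain k where k: "k < N" "e k = h \<otimes>\<^bsub>G\<^esub> e j" using e by (force simp: bij_betw_def)
      have "(R g * R h) $$ (i,j) =
         (\<Sum>l<N. (if e i = g \<otimes>\<^bsub>G\<^esub> e l then 1 else 0) * (if e l = h \<otimes>\<^bsub>G\<^esub> e j then 1 else 0))"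
        using ij by (auto simp: R_def scalar_prod_def atLeast0LessThan intro!: sum.cong)
      also have "\<dots> = (\<Sum>l<N. if l = k then (if e i = g \<otimes>\<^bsub>G\<^esub> e k then 1 else 0) else 0)"
        by (rule sum.cong) (auto simp: k(2)[symmetric] einj k(1))
      also have "\<dots> = (if e i = g \<otimes>\<^bsub>G\<^esub> e k then 1 else 0)" using k by simp
      also have "\<dots> = R (g \<otimes>\<^bsub>G\<^esub> h) $$ (i,j)"
        using ij k gh ec by (simp add: R_def m_assoc)
      finally show "R (g \<otimes>\<^bsub>G\<^esub> h) $$ (i,j) = (R g * R h) $$ (i,j)" by simp
    qed (auto simp: R_def)
  qed
  have fixed: "g = \<one>\<^bsub>G\<^esub>" if "g \<in> carrier G" "i < N" "e i = g \<otimes>\<^bsub>G\<^esub> e i" for g i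
    using that ec[OF that(2)] by (metis l_one one_closed right_cancel)
  have "g = \<one>\<^bsub>G\<^esub>" if g: "g \<in> carrier G" "R g = 1\<^sub>m N" for g
  proof (rule ccontr)
    assume "g \<noteq> \<one>\<^bsub>G\<^esub>"
    then have "R g $$ (0,0) = 0" using fixed[OF g(1) N0] N0 by (auto simp: R_def)
    then show False using g(2) N0 by simp
  qed
  moreover have "mat_trace (R g) = 0" if "g \<in> carrier G" "g \<noteq> \<one>\<^bsub>G\<^esub>" for g
    unfolding mat_trace_def using fixed[OF that(1)] that(2)
    by (intro sum.neutral) (auto simp: R_def)
  ultimately show ?thesis using rep unfolding N_def by blast
qed

text \<open>If every composition factor of the regular representation were trivial at
  \<open>z\<close>, the regular representation itself would be, by the last clause of
  \<open>composition_factors\<close>.\<close>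

lemma irreducible_nontrivial_at:
  assumes G: "group G" and fin: "finite (carrier G)" and z: "z \<in> carrier G" "z \<noteq> \<one>\<^bsub>G\<^esub>"
  shows "\<exists>n \<sigma>. irreducible_representation G n \<sigma> \<and> \<sigma> z \<noteq> 1\<^sub>m n"
proof -
  obtain \<rho> where \<rho>: "representation G (Coset.order G) \<rho>" "\<rho> z \<noteq> 1\<^sub>m (Coset.order G)"
    using regular_representation[OF G fin] z by blast
  from composition_factors[OF G fin \<rho>(1)] show ?thesis using \<rho>(2) z(1) by fastforce
qed

text \<open>The image of \<open>z\<close> in the abelian quotient G/G' is nontrivial, hence detected
  by an irreducible representation of the quotient. That one has dimension 1, and it is inflated to
  G along the coset map.\<close>

lemma linear_nontrivial_at:
  assumes G: "group G" and fin: "finite (carrier G)"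
    and z: "z \<in> carrier G" "z \<notin> derived G (carrier G)"
  shows "\<exists>\<sigma>. representation G 1 \<sigma> \<and> \<sigma> z \<noteq> 1\<^sub>m 1"
proof -
  interpret group G by fact
  let ?D = "derived G (carrier G)" and ?Q = "G Mod derived G (carrier G)"
  interpret D: normal ?D G by (rule derived_self_is_normal)
  interpret Q: comm_group ?Q by (rule derived_quot_is_comm_group)
  have hom: "(\<lambda>g. ?D #>\<^bsub>G\<^esub> g) \<in> hom G ?Q" by (rule D.r_coset_hom_Mod)
  have cz: "?D #>\<^bsub>G\<^esub> z \<in> carrier ?Q" using z(1) by (auto simp: FactGroup_def RCOSETS_def)
  have "?D #>\<^bsub>G\<^esub> z \<noteq> \<one>\<^bsub>?Q\<^esub>"
    using z coset_join1[OF _ z(1) D.subgroup_axioms] by (auto simp: FactGroup_def)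
  moreover have "finite (carrier ?Q)" using fin by (simp add: FactGroup_def RCOSETS_def)
  ultimately obtain n \<sigma> where irr: "irreducible_representation ?Q n \<sigma>" and \<sigma>: "\<sigma> (?D #>\<^bsub>G\<^esub> z) \<noteq> 1\<^sub>m n"
    using irreducible_nontrivial_at[OF Q.group_axioms _ cz] by blast
  note rep = irreducible_representationD(1)[OF irr]
  have "n = 1"
  proof (rule irreducible_commutative_dim[OF Q.group_axioms irr])
    fix g h assume gh: "g \<in> carrier ?Q" "h \<in> carrier ?Q"
    show "\<sigma> g * \<sigma> h = \<sigma> h * \<sigma> g"
      using representation_mult[OF Q.group_axioms rep gh] representation_mult[OF Q.group_axioms rep gh(2,1)]
        Q.m_comm[OF gh] by argo
  qed
  moreover have "representation G n (\<lambda>g. \<sigma> (?D #>\<^bsub>G\<^esub> g))"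
    using rep hom unfolding representation_def hom_def by (auto simp: Pi_def)
  ultimately show ?thesis using \<sigma> by blast
qed

lemma commutative_trivial_on_derived:
  assumes G: "group G" and \<rho>: "representation G n \<rho>"
    and comm: "\<And>g h. g \<in> carrier G \<Longrightarrow> h \<in> carrier G \<Longrightarrow> \<rho> g * \<rho> h = \<rho> h * \<rho> g"
    and u: "u \<in> derived G (carrier G)"
  shows "\<rho> u = 1\<^sub>m n"
proof -
  interpret group G by fact
  have c: "\<rho> g \<in> carrier_mat n n" if "g \<in> carrier G" for g by (rule representation_carrier[OF G \<rho> that])
  note m = representation_mult[OF G \<rho>]
  let ?K = "{w\<in>carrier G. \<rho> w = 1\<^sub>m n}"
  have K: "subgroup ?K G" by (rule representation_kernel_subgroup[OF G \<rho> subgroup_self])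
  have "a \<otimes>\<^bsub>G\<^esub> b \<otimes>\<^bsub>G\<^esub> inv\<^bsub>G\<^esub> a \<otimes>\<^bsub>G\<^esub> inv\<^bsub>G\<^esub> b \<in> ?K" if ab: "a \<in> carrier G" "b \<in> carrier G" for a b
  proof -
    have "\<rho> (a \<otimes>\<^bsub>G\<^esub> b \<otimes>\<^bsub>G\<^esub> inv\<^bsub>G\<^esub> a \<otimes>\<^bsub>G\<^esub> inv\<^bsub>G\<^esub> b) = \<rho> (a \<otimes>\<^bsub>G\<^esub> b) * \<rho> (inv\<^bsub>G\<^esub> a) * \<rho> (inv\<^bsub>G\<^esub> b)"
      using ab by (simp add: m)
    also have "\<rho> (a \<otimes>\<^bsub>G\<^esub> b) = \<rho> (b \<otimes>\<^bsub>G\<^esub> a)" using m[OF ab] m[OF ab(2,1)] comm[OF ab] by simp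
    also have "\<rho> (b \<otimes>\<^bsub>G\<^esub> a) * \<rho> (inv\<^bsub>G\<^esub> a) * \<rho> (inv\<^bsub>G\<^esub> b) = \<rho> (b \<otimes>\<^bsub>G\<^esub> a \<otimes>\<^bsub>G\<^esub> inv\<^bsub>G\<^esub> a \<otimes>\<^bsub>G\<^esub> inv\<^bsub>G\<^esub> b)"
      using ab by (simp add: m)
    also have "b \<otimes>\<^bsub>G\<^esub> a \<otimes>\<^bsub>G\<^esub> inv\<^bsub>G\<^esub> a \<otimes>\<^bsub>G\<^esub> inv\<^bsub>G\<^esub> b = \<one>\<^bsub>G\<^esub>" using ab by (simp add: m_assoc)
    finally show ?thesis using representation_one[OF G \<rho>] ab by simp
  qed
  then have "derived G (carrier G) \<subseteq> ?K"
    unfolding derived_def by (intro generate_subgroup_incl[OF _ K]) auto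
  then show ?thesis using u by blast
qed

lemma linear_trivial_on_derived:
  assumes G: "group G" and \<rho>: "representation G 1 \<rho>" and u: "u \<in> derived G (carrier G)"
  shows "\<rho> u = 1\<^sub>m 1"
proof (rule commutative_trivial_on_derived[OF G \<rho> _ u])
  fix g h assume "g \<in> carrier G" "h \<in> carrier G"
  then have "\<rho> g \<in> carrier_mat 1 1" "\<rho> h \<in> carrier_mat 1 1"
    using representation_carrier[OF G \<rho>] by auto
  then show "\<rho> g * \<rho> h = \<rho> h * \<rho> g"
    by (intro eq_matI) (auto simp: scalar_prod_def mult.commute)
qed

section \<open>Central elements and the characters of VZ-groups\<close>

lemma center_subgroup:
  assumes "group G"
  shows "subgroup (center G) G"
proof -
  interpret group G by fact
  show ?thesis
  proof (rule subgroupI)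
    fix a assume a: "a \<in> center G"
    then have ac: "a \<in> carrier G" by (simp add: center_def)
    show "inv\<^bsub>G\<^esub> a \<in> center G"
      unfolding center_def
    proof (intro CollectI conjI ballI)
      fix g assume g: "g \<in> carrier G"
      then have "a \<otimes>\<^bsub>G\<^esub> g = g \<otimes>\<^bsub>G\<^esub> a" using a by (simp add: center_def)
      then show "inv\<^bsub>G\<^esub> a \<otimes>\<^bsub>G\<^esub> g = g \<otimes>\<^bsub>G\<^esub> inv\<^bsub>G\<^esub> a"
        using ac g by (metis inv_closed inv_solve_left inv_solve_right m_assoc m_closed)
    qed (use ac in simp)
  next
    fix a b assume "a \<in> center G" "b \<in> center G"
    then have a: "a \<in> carrier G" "\<And>g. g \<in> carrier G \<Longrightarrow> a \<otimes>\<^bsub>G\<^esub> g = g \<otimes>\<^bsub>G\<^esub> a"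
      and b: "b \<in> carrier G" "\<And>g. g \<in> carrier G \<Longrightarrow> b \<otimes>\<^bsub>G\<^esub> g = g \<otimes>\<^bsub>G\<^esub> b"
      unfolding center_def by blast+
    have "a \<otimes>\<^bsub>G\<^esub> b \<otimes>\<^bsub>G\<^esub> g = g \<otimes>\<^bsub>G\<^esub> (a \<otimes>\<^bsub>G\<^esub> b)" if g: "g \<in> carrier G" for g
    proof -
      have "a \<otimes>\<^bsub>G\<^esub> b \<otimes>\<^bsub>G\<^esub> g = a \<otimes>\<^bsub>G\<^esub> (g \<otimes>\<^bsub>G\<^esub> b)"
        using a(1) b(1) g b(2)[OF g] by (simp add: m_assoc)
      also have "\<dots> = g \<otimes>\<^bsub>G\<^esub> a \<otimes>\<^bsub>G\<^esub> b" using a(1) b(1) g a(2)[OF g] by (simp flip: m_assoc)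
      finally show ?thesis using a(1) b(1) g by (simp add: m_assoc)
    qed
    then show "a \<otimes>\<^bsub>G\<^esub> b \<in> center G"
      unfolding center_def using a(1) b(1) by blast
  qed (auto simp: center_def)
qed

lemma central_scalar:
  assumes G: "group G" and irr: "irreducible_representation G n \<rho>" and z: "z \<in> center G"
  shows "\<exists>c. \<rho> z = c \<cdot>\<^sub>m 1\<^sub>m n"
proof -
  note \<rho> = irreducible_representationD(1)[OF irr]
  have zc: "z \<in> carrier G" using z by (simp add: center_def)
  have "\<rho> g * \<rho> z = \<rho> z * \<rho> g" if "g \<in> carrier G" for g
    using representation_mult[OF G \<rho> that zc] representation_mult[OF G \<rho> zc that] z that
    by (simp add: center_def)
  then show ?thesis by (rule schur[OF G irr representation_carrier[OF G \<rho> zc]])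
qed

text \<open>Translates the definition, which speaks of characters and their value at the identity,
  into dimensions: that value is \<open>n\<close>, and a positive \<open>n\<close> other than 1
  exceeds 1 in the order on the complex numbers.\<close>

lemma VZ_trace_zero:
  assumes VZ: "VZ_group G" and irr: "irreducible_representation G n \<rho>" and n: "n \<noteq> 1"
    and g: "g \<in> carrier G" "g \<notin> center G"
  shows "mat_trace (\<rho> g) = 0"
proof -
  have G: "group G" using VZ by (simp add: VZ_group_def)
  note \<rho> = irreducible_representationD(1)[OF irr]
  have n1: "1 < n" using irreducible_representationD(2)[OF irr] n by simp
  have "\<one>\<^bsub>G\<^esub> \<in> carrier G" using G by (simp add: group.is_monoid)
  then have "character G \<rho> \<one>\<^bsub>G\<^esub> > 1"
    using n1 representation_one[OF G \<rho>] by (simp add: character_def less_complex_def)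
  moreover have "character G \<rho> \<in> irreducible_characters G"
    unfolding irreducible_characters_def using irr by blast
  ultimately have "character G \<rho> g = 0" using VZ g unfolding VZ_group_def by blast
  then show ?thesis using g(1) by (simp add: character_def)
qed

text \<open>A central element and its inverse act by scalars c and d with cd = 1, so every central
  term of the norm formula is the square of \<open>n\<close>, whatever c is. Hence |G| equals |Z|
  times that square.\<close>

lemma VZ_degree_square:
  assumes VZ: "VZ_group G" and irr: "irreducible_representation G n \<rho>" and n: "n \<noteq> 1"
  shows "n * n = card (rcosets\<^bsub>G\<^esub> (center G))"
proof -
  have G: "group G" and fin: "finite (carrier G)" using VZ by (auto simp: VZ_group_def)
  interpret group G by fact
  interpret Z: subgroup "center G" G by (rule center_subgroup[OF G])
  note \<rho> = irreducible_representationD(1)[OF irr]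
  have "of_nat (Coset.order G) = (\<Sum>g\<in>carrier G. mat_trace (\<rho> g) * mat_trace (\<rho> (inv\<^bsub>G\<^esub> g)))"
    by (rule irreducible_character_norm[OF G fin irr, symmetric])
  also have "\<dots> = (\<Sum>g\<in>center G. mat_trace (\<rho> g) * mat_trace (\<rho> (inv\<^bsub>G\<^esub> g)))"
    by (rule sum.mono_neutral_right[OF fin Z.subset]) (auto simp: VZ_trace_zero[OF VZ irr n])
  also have "\<dots> = (\<Sum>g\<in>center G. of_nat (n * n))"
  proof (rule sum.cong)
    fix z assume z: "z \<in> center G"
    obtain c where c: "\<rho> z = c \<cdot>\<^sub>m 1\<^sub>m n" using central_scalar[OF G irr z] by blast
    obtain d where d: "\<rho> (inv\<^bsub>G\<^esub> z) = d \<cdot>\<^sub>m 1\<^sub>m n"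
      using central_scalar[OF G irr Z.m_inv_closed[OF z]] by blast
    have "c \<cdot>\<^sub>m 1\<^sub>m n * (d \<cdot>\<^sub>m 1\<^sub>m n) = 1\<^sub>m n"
      using representation_inv(1)[OF G \<rho> Z.mem_carrier[OF z]] c d by simp
    moreover have "c \<cdot>\<^sub>m 1\<^sub>m n * (d \<cdot>\<^sub>m 1\<^sub>m n) = c \<cdot>\<^sub>m (d \<cdot>\<^sub>m 1\<^sub>m n)"
      using mult_smult_assoc_mat[OF one_carrier_mat, of "d \<cdot>\<^sub>m 1\<^sub>m n" n n c] by simp
    ultimately have "(c \<cdot>\<^sub>m (d \<cdot>\<^sub>m 1\<^sub>m n)) $$ (0,0) = 1\<^sub>m n $$ (0,0)" by simp
    then have "c * d = 1" using irreducible_representationD(2)[OF irr] by simp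
    have "mat_trace (\<rho> z) * mat_trace (\<rho> (inv\<^bsub>G\<^esub> z)) = (c * of_nat n) * (d * of_nat n)"
      by (simp add: c d mat_trace_smult[of _ n])
    also have "\<dots> = (c * d) * of_nat (n * n)" by (simp add: algebra_simps)
    finally show "mat_trace (\<rho> z) * mat_trace (\<rho> (inv\<^bsub>G\<^esub> z)) = of_nat (n * n)"
      using \<open>c * d = 1\<close> by simp
  qed simp
  finally have "(of_nat (Coset.order G) :: complex) = of_nat (card (center G) * (n * n))" by simp
  then have "Coset.order G = card (center G) * (n * n)" using of_nat_eq_iff by blast
  moreover have "card (rcosets\<^bsub>G\<^esub> (center G)) * card (center G) = Coset.order G"
    by (rule lagrange[OF Z.subgroup_axioms])
  moreover have "0 < card (center G)"
    using fin Z.subset Z.one_closed by (metis card_gt_0_iff empty_iff finite_subset)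
  ultimately show ?thesis by (metis mult.commute mult_cancel_right less_not_refl)
qed

text \<open>For a noncentral element of the commutator subgroup, the vanishing trace in the regular
  representation counts the linear constituents, among them the trivial one.\<close>

lemma VZ_derived_central:
  assumes VZ: "VZ_group G"
  shows "derived G (carrier G) \<subseteq> center G"
proof (rule ccontr)
  have G: "group G" and fin: "finite (carrier G)" using VZ by (auto simp: VZ_group_def)
  interpret group G by fact
  assume "\<not> ?thesis"
  then obtain u where u: "u \<in> derived G (carrier G)" "u \<notin> center G" by blast
  have uc: "u \<in> carrier G" using u(1) derived_in_carrier[of "carrier G"] by auto
  have u1: "u \<noteq> \<one>\<^bsub>G\<^esub>" using u(2) by (auto simp: center_def)
  obtain R where R: "representation G (Coset.order G) R"
    and tr0: "\<forall>g\<in>carrier G. g \<noteq> \<one>\<^bsub>G\<^esub> \<longrightarrow> mat_trace (R g) = 0"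
    using regular_representation[OF G fin] by blast
  obtain xs where irr: "\<forall>(m,\<sigma>)\<in>set xs. irreducible_representation G m \<sigma>"
    and tr: "\<forall>g\<in>carrier G. mat_trace (R g) = (\<Sum>(m,\<sigma>)\<leftarrow>xs. mat_trace (\<sigma> g))"
    using composition_factors[OF G fin R] by blast
  have "mat_trace (\<sigma> u) = (if m = 1 then 1 else 0)" if "(m,\<sigma>) \<in> set xs" for m \<sigma>
  proof (cases "m = 1")
    case True
    then have "\<sigma> u = 1\<^sub>m 1"
      using linear_trivial_on_derived[OF G _ u(1)] irr that irreducible_representationD(1) by fast
    then show ?thesis using True by simp
  next
    case False
    then show ?thesis using VZ_trace_zero[OF VZ _ _ uc u(2)] irr that by auto
  qed
  then have "(\<Sum>(m,\<sigma>)\<leftarrow>xs. mat_trace (\<sigma> u)) = (\<Sum>(m,\<sigma>)\<leftarrow>xs. if m = 1 then 1 else 0)"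
    by (intro arg_cong[of _ _ sum_list] map_cong) auto
  moreover have "(\<Sum>(m,\<sigma>)\<leftarrow>xs. if m = 1 then 1 else 0) = (of_nat (\<Sum>(m,\<sigma>)\<leftarrow>xs. if m = 1 then 1 else 0) :: complex)"
    by (induction xs) auto
  ultimately have "(of_nat (\<Sum>(m,\<sigma>)\<leftarrow>xs. if m = 1 then 1 else 0) :: complex) = 0"
    using tr tr0 uc u1 by simp
  \<comment> \<open>Read in the natural numbers, the vanishing of a sum of zeros and ones forces
    every term to vanish.\<close>
  then have "(\<Sum>(m,\<sigma>)\<leftarrow>xs. if m = 1 then 1 else 0 :: nat) = 0" using of_nat_eq_0_iff by blast
  then have nolin: "m \<noteq> 1" if "(m,\<sigma>) \<in> set xs" for m \<sigma>
    using that by (auto simp: sum_list_eq_0_iff split: if_splits)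
  \<comment> \<open>The contradiction: summed over the group, the regular trace is |G|, coming from
    the identity alone, while constituents that are all nonlinear contribute 0.\<close>
  have "of_nat (Coset.order G) = mat_trace (R \<one>\<^bsub>G\<^esub>)" using representation_one[OF G R] by simp
  also have "\<dots> = (\<Sum>g\<in>carrier G. mat_trace (R g))"
    using sum.mono_neutral_left[OF fin, of "{\<one>\<^bsub>G\<^esub>}" "\<lambda>g. mat_trace (R g)"] tr0 by simp
  also have "\<dots> = (\<Sum>g\<in>carrier G. \<Sum>(m,\<sigma>)\<leftarrow>xs. mat_trace (\<sigma> g))" using tr by simp
  also have "\<dots> = (\<Sum>(m,\<sigma>)\<leftarrow>xs. \<Sum>g\<in>carrier G. mat_trace (\<sigma> g))"
    by (induction xs) (auto simp: sum.distrib)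
  also have "\<dots> = (\<Sum>x\<leftarrow>xs. 0)"
    using irreducible_trace_sum_zero[OF G fin] irr nolin
    by (intro arg_cong[of _ _ sum_list] map_cong) auto
  also have "\<dots> = 0" by simp
  finally have "(of_nat (Coset.order G) :: complex) = 0" .
  then show False using order_gt_0_iff_finite fin by simp
qed

section \<open>Minimal generating sets of finite abelian p-groups\<close>

lemma p_group_subgroup_card:
  assumes "prime (p::nat)" "group G" "Coset.order G = p ^ k" "subgroup H G"
  shows "\<exists>a. card H = p ^ a"
proof -
  have "card H dvd Coset.order G" using group.lagrange[OF assms(2,4)] by (metis dvd_triv_right)
  then show ?thesis using assms(1,3) divides_primepow_nat by auto
qed

text \<open>Both orders are powers of p, so a strict inclusion gains a full factor p. This drives
  both greedy arguments below: choosing generators and cutting kernels.\<close>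

lemma p_group_proper_subgroup_card:
  assumes p: "prime (p::nat)" and G: "group G" "Coset.order G = p ^ k"
    and H: "subgroup H G" and K: "subgroup K G" and HK: "H \<subset> K"
  shows "p * card H \<le> card K"
proof -
  obtain a b where ab: "card H = p ^ a" "card K = p ^ b"
    using p_group_subgroup_card[OF p G] H K by metis
  have "0 < Coset.order G" using G(2) p by (simp add: prime_gt_0_nat)
  then have "finite (carrier G)" using G(1) by (simp add: group.is_monoid monoid.order_gt_0_iff_finite)
  then have "finite K" using K by (meson finite_subset subgroup.subset)
  then have "card H < card K" using HK psubset_card_mono by blast
  then have "a < b" using ab prime_gt_1_nat[OF p] power_less_imp_less_exp by simp
  then have "p ^ Suc a \<le> p ^ b" using p by (intro power_increasing) (auto simp: Suc_le_eq prime_gt_0_nat)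
  then show ?thesis using ab by simp
qed

lemma (in group) subgroup_nat_pow_closed:
  assumes "subgroup H G" "h \<in> H"
  shows "h [^] (n::nat) \<in> H"
  using assms by (induction n) (auto simp: subgroup.one_closed subgroup.m_closed)

lemma (in comm_group) power_image_subgroup: "subgroup ((\<lambda>x. x [^] (n::nat)) ` carrier G) G"
proof (rule subgroupI)
  fix a b assume "a \<in> (\<lambda>x. x [^] n) ` carrier G" "b \<in> (\<lambda>x. x [^] n) ` carrier G"
  then show "a \<otimes> b \<in> (\<lambda>x. x [^] n) ` carrier G"
    by (auto simp flip: pow_mult_distrib[OF m_comm])
next
  fix a assume "a \<in> (\<lambda>x. x [^] n) ` carrier G"
  then show "inv a \<in> (\<lambda>x. x [^] n) ` carrier G"
    by (auto simp flip: nat_pow_inv)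
qed auto

lemma (in comm_group) power_kernel_subgroup: "subgroup {x \<in> carrier G. x [^] (n::nat) = \<one>} G"
proof (rule subgroupI)
  fix a b assume "a \<in> {x \<in> carrier G. x [^] n = \<one>}" "b \<in> {x \<in> carrier G. x [^] n = \<one>}"
  then show "a \<otimes> b \<in> {x \<in> carrier G. x [^] n = \<one>}"
    by (auto simp: pow_mult_distrib[OF m_comm])
next
  fix a assume "a \<in> {x \<in> carrier G. x [^] n = \<one>}"
  then show "inv a \<in> {x \<in> carrier G. x [^] n = \<one>}"
    by (auto simp: nat_pow_inv)
qed (auto intro!: exI[of _ \<one>])

text \<open>In an abelian group the power map is a homomorphism, and its fibres are translates of
  its kernel.\<close>

lemma (in comm_group) card_power_kernel_image:
  assumes fin: "finite (carrier G)"
  shows "card {x \<in> carrier G. x [^] (n::nat) = \<one>} * card ((\<lambda>x. x [^] n) ` carrier G) = Coset.order G"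
proof -
  let ?K = "{x \<in> carrier G. x [^] n = \<one>}" and ?f = "\<lambda>x. x [^] n"
  have "Coset.order G = (\<Sum>x\<in>carrier G. 1)" by (simp add: Coset.order_def)
  also have "\<dots> = (\<Sum>y\<in>?f ` carrier G. \<Sum>x\<in>{x \<in> carrier G. ?f x = y}. 1)"
    by (rule sum.image_gen[OF fin])
  also have "\<dots> = (\<Sum>y\<in>?f ` carrier G. card ?K)"
  proof (rule sum.cong)
    fix y assume "y \<in> ?f ` carrier G"
    then obtain z where z: "z \<in> carrier G" "y = z [^] n" by blast
    have "bij_betw (\<lambda>w. w \<otimes> z) ?K {x \<in> carrier G. ?f x = y}"
      by (rule bij_betw_byWitness[of _ "\<lambda>x. x \<otimes> inv z"])
         (use z in \<open>auto simp: m_assoc pow_mult_distrib[OF m_comm] nat_pow_inv\<close>)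
    then show "(\<Sum>x\<in>{x \<in> carrier G. ?f x = y}. 1) = card ?K"
      using bij_betw_same_card by fastforce
  qed simp
  finally show ?thesis by (simp add: mult.commute)
qed

text \<open>As the p-th power of \<open>x\<close> lies in \<open>H\<close>, the union of the p
  translates of \<open>H\<close> by the powers of \<open>x\<close> below p is already a subgroup;
  exponents are reduced by moving p-th powers into \<open>H\<close>.\<close>

lemma (in comm_group) card_generate_insert_le:
  assumes fin: "finite (carrier G)" and H: "subgroup H G" and x: "x \<in> carrier G"
    and p: "0 < (p::nat)" and xp: "x [^] p \<in> H"
  shows "card (generate G (insert x H)) \<le> p * card H"
proof -
  interpret H: subgroup H G by fact
  define K where "K = (\<lambda>(h,i). h \<otimes> x [^] i) ` (H \<times> {..<p})"
  have K: "h \<otimes> x [^] i \<in> K" if h: "h \<in> H" for h and i :: nat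
  proof -
    have "x [^] i = (x [^] p) [^] (i div p) \<otimes> x [^] (i mod p)"
      using x by (simp add: nat_pow_pow nat_pow_mult)
    moreover have "(x [^] p) [^] (i div p) \<in> H"
      by (rule subgroup_nat_pow_closed[OF H xp])
    ultimately have "h \<otimes> x [^] i = (h \<otimes> (x [^] p) [^] (i div p)) \<otimes> x [^] (i mod p)"
      "h \<otimes> (x [^] p) [^] (i div p) \<in> H" using h x by (auto simp: m_assoc)
    then show ?thesis unfolding K_def using p by force
  qed
  have "subgroup K G"
  proof (rule subgroupI)
    show "K \<subseteq> carrier G" unfolding K_def using x by auto
    show "K \<noteq> {}" using K[OF H.one_closed] by blast
    fix a assume "a \<in> K"
    then obtain h i where a: "h \<in> H" "a = h \<otimes> x [^] (i::nat)" unfolding K_def by auto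
    \<comment> \<open>A natural exponent for the inverse of the i-th power of \<open>x\<close>:
      multiplying by the exponent pi - i gives the i-th power of an element of
      \<open>H\<close>.\<close>
    have "x [^] i \<otimes> x [^] (p * i - i) = x [^] (p * i)"
      using x p by (simp add: nat_pow_mult)
    then have e: "x [^] i \<otimes> x [^] (p * i - i) = (x [^] p) [^] i" using x by (simp add: nat_pow_pow)
    define u where "u = (x [^] p) [^] i"
    have u: "u \<in> H" unfolding u_def by (rule subgroup_nat_pow_closed[OF H xp])
    have "h \<otimes> c \<otimes> (h' \<otimes> u' \<otimes> d) = (h \<otimes> h') \<otimes> (u' \<otimes> (c \<otimes> d))"
      if "c \<in> carrier G" "h' \<in> carrier G" "u' \<in> carrier G" "d \<in> carrier G" for c d h' u'
      using a(1) that by (simp add: m_ac)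
    then have "a \<otimes> (inv h \<otimes> inv u \<otimes> x [^] (p * i - i)) = (h \<otimes> inv h) \<otimes> (inv u \<otimes> (x [^] i \<otimes> x [^] (p * i - i)))"
      unfolding a(2) using a(1) u x by simp
    also have "\<dots> = \<one>" using a u e by (simp add: u_def[symmetric])
    finally have "inv a = inv h \<otimes> inv u \<otimes> x [^] (p * i - i)"
      using a u x by (metis H.m_inv_closed H.mem_carrier inv_comm inv_equality m_closed nat_pow_closed)
    then show "inv a \<in> K" using K[of "inv h \<otimes> inv u"] a u by simp
  next
    fix a b assume "a \<in> K" "b \<in> K"
    then obtain h i h' i' where a: "h \<in> H" "a = h \<otimes> x [^] (i::nat)" and b: "h' \<in> H" "b = h' \<otimes> x [^] (i'::nat)"
      unfolding K_def by auto
    have "a \<otimes> b = h \<otimes> h' \<otimes> x [^] (i + i')"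
      using a b x by (simp add: m_ac flip: nat_pow_mult)
    then show "a \<otimes> b \<in> K" using K[of "h \<otimes> h'"] a b by simp
  qed
  moreover have "insert x H \<subseteq> K"
  proof
    fix y assume "y \<in> insert x H"
    then show "y \<in> K" using K[OF H.one_closed, of 1] K[of y 0] x by auto
  qed
  ultimately have "generate G (insert x H) \<subseteq> K" by (intro generate_subgroup_incl)
  moreover have finH: "finite H" using fin H.subset finite_subset by blast
  then have "finite K" unfolding K_def by simp
  ultimately have "card (generate G (insert x H)) \<le> card K" by (intro card_mono)
  also have "\<dots> \<le> card (H \<times> {..<p})" unfolding K_def using finH by (intro card_image_le) simp
  also have "\<dots> = p * card H" by (simp add: card_cartesian_product)
  finally show ?thesis .
qed

lemma (in comm_group) generate_power_image_Un:
  assumes k: "Coset.order G = p ^ k" and S: "S \<subseteq> carrier G"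
    and gen: "generate G ((\<lambda>x. x [^] (p::nat)) ` carrier G \<union> S) = carrier G"
  shows "generate G S = carrier G"
proof
  let ?P = "(\<lambda>x. x [^] p) ` carrier G" and ?A = "generate G S"
  have A: "subgroup ?A G" by (rule generate_is_subgroup[OF S])
  interpret A: subgroup ?A G by fact
  interpret P: subgroup ?P G by (rule power_image_subgroup)
  have "?P \<union> S \<subseteq> ?A <#> ?P"
  proof
    fix y assume y: "y \<in> ?P \<union> S"
    have "y = \<one> \<otimes> y" "y = y \<otimes> \<one>" using y S by auto
    moreover have "S \<subseteq> ?A" by (intro subsetI generate.incl)
    ultimately show "y \<in> ?A <#> ?P"
      using y A.one_closed P.one_closed unfolding set_mult_def by blast
  qed
  then have AP: "carrier G \<subseteq> ?A <#> ?P"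
    using generate_subgroup_incl[OF _ mult_subgroups[OF A P.subgroup_axioms]] gen by blast
  have step: "\<exists>a\<in>?A. \<exists>y\<in>carrier G. x = a \<otimes> y [^] (p ^ j)" if "x \<in> carrier G" for x j
  proof (induction j)
    case 0
    then show ?case using that A.one_closed by (intro bexI[of _ \<one>] bexI[of _ x]) auto
  next
    case (Suc j)
    then obtain a y where ay: "a \<in> ?A" "y \<in> carrier G" "x = a \<otimes> y [^] (p ^ j)" by blast
    obtain b z where bz: "b \<in> ?A" "z \<in> carrier G" "y = b \<otimes> z [^] p"
      using AP ay(2) unfolding set_mult_def by blast
    have bc: "b [^] (p ^ j) \<in> ?A"
      by (rule subgroup_nat_pow_closed[OF A bz(1)])
    have "x = a \<otimes> (b [^] (p ^ j) \<otimes> z [^] (p ^ Suc j))"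
      using ay bz A.mem_carrier by (simp add: pow_mult_distrib[OF m_comm] nat_pow_pow)
    also have "\<dots> = (a \<otimes> b [^] (p ^ j)) \<otimes> z [^] (p ^ Suc j)"
      using ay bz A.mem_carrier by (simp add: m_assoc)
    finally show ?case using ay bz bc by blast
  qed
  show "carrier G \<subseteq> ?A"
  proof
    fix x assume x: "x \<in> carrier G"
    obtain a y where "a \<in> ?A" "y \<in> carrier G" "x = a \<otimes> y [^] (p ^ k)" using step[OF x] by blast
    then show "x \<in> ?A" using pow_order_eq_1[of y] k by simp
  qed
  show "?A \<subseteq> carrier G" by (rule A.subset)
qed

text \<open>The kernel of the p-th power map has as many elements as the index of its image P. That
  index is bounded by counting how much one added generator can enlarge a subgroup containing P: at
  most by a factor p always, and at least by p when the generator is new.\<close>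

lemma (in comm_group) card_power_kernel_eq_min_generators:
  assumes p: "prime (p::nat)" and k: "Coset.order G = p ^ k"
  shows "card {x \<in> carrier G. x [^] p = \<one>} = p ^ min_generators G"
proof -
  let ?P = "(\<lambda>x. x [^] p) ` carrier G" and ?K = "{x \<in> carrier G. x [^] p = \<one>}"
  interpret P: subgroup ?P G by (rule power_image_subgroup)
  have p0: "0 < p" using p by (simp add: prime_gt_0_nat)
  have "0 < Coset.order G" using k p0 by simp
  then have fin: "finite (carrier G)" by (simp add: order_gt_0_iff_finite)
  have KP: "card ?K * card ?P = p ^ k" using card_power_kernel_image[OF fin, of p] k by simp
  have P0: "0 < card ?P" using KP p0 by (metis gr0I mult_0_right power_not_zero)
  define gens where "gens n \<longleftrightarrow> (\<exists>S. S \<subseteq> carrier G \<and> finite S \<and> card S = n \<and> generate G S = carrier G)" for n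
  \<comment> \<open>Starting from P, each of the n generators multiplies the order by at most p, and
    the end result is the whole group.\<close>
  have upper: "card ?K \<le> p ^ n" if gn: "gens n" for n
  proof -
    obtain S where S: "S \<subseteq> carrier G" "finite S" "card S = n" "generate G S = carrier G"
      using gn unfolding gens_def by blast
    have "card (generate G (?P \<union> T)) \<le> p ^ card T * card ?P" if "finite T" "T \<subseteq> carrier G" for T
      using that
    proof (induction T)
      case empty
      have "generate G (?P \<union> {}) \<subseteq> ?P" using generate_subgroup_incl[OF subset_refl P.subgroup_axioms] by simp
      then have "card (generate G (?P \<union> {})) \<le> card ?P" using fin by (intro card_mono) simp
      then show ?case by simp
    next
      case (insert x T)
      let ?H = "generate G (?P \<union> T)"
      have PT: "?P \<union> T \<subseteq> carrier G" using insert by auto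
      have H: "subgroup ?H G" by (rule generate_is_subgroup[OF PT])
      have PTH: "?P \<union> T \<subseteq> ?H" by (intro subsetI generate.incl)
      have "generate G (?P \<union> insert x T) \<subseteq> generate G (insert x ?H)"
        using PTH by (intro mono_generate) blast
      moreover have "generate G (insert x ?H) \<subseteq> carrier G"
        using insert H by (intro generate_incl) (auto dest: subgroup.mem_carrier)
      ultimately have "card (generate G (?P \<union> insert x T)) \<le> card (generate G (insert x ?H))"
        using fin by (meson card_mono finite_subset)
      also have "\<dots> \<le> p * card ?H"
      proof (rule card_generate_insert_le[OF fin H _ p0])
        show "x \<in> carrier G" using insert by simp
        then show "x [^] p \<in> ?H" using PTH by blast
      qed
      also have "\<dots> \<le> p * (p ^ card T * card ?P)" using insert by simp
      finally show ?case using insert by simp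
    qed
    from this[OF S(2,1)] have "card (generate G (?P \<union> S)) \<le> p ^ n * card ?P" using S(3) by simp
    moreover have "carrier G \<subseteq> generate G (?P \<union> S)"
      using S(4) mono_generate[of S "?P \<union> S"] by blast
    then have "generate G (?P \<union> S) = carrier G"
      using generate_incl[of "?P \<union> S"] S(1) by auto
    ultimately have "card ?K * card ?P \<le> p ^ n * card ?P" using KP k by (simp add: Coset.order_def)
    then show ?thesis using P0 by simp
  qed
  have lower: "\<exists>n. gens n \<and> p ^ n \<le> card ?K"
  proof -
    \<comment> \<open>The sets whose every element could have paid a full factor p. A largest one,
      together with P, generates the group, since any element outside could be added with another
      gain of p.\<close>
    define C where "C = {S. S \<subseteq> carrier G \<and> p ^ card S * card ?P \<le> card (generate G (?P \<union> S))}"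
    have finC: "finite C" unfolding C_def using fin by simp
    have "generate G (?P \<union> {}) = ?P"
      using generate_subgroup_incl[OF subset_refl P.subgroup_axioms] by (auto intro: generate.incl)
    then have "{} \<in> C" by (simp add: C_def)
    then have "Max (card ` C) \<in> card ` C" using finC by (intro Max_in) auto
    then obtain S where S: "S \<in> C" and cS: "card S = Max (card ` C)" by auto
    have max: "card T \<le> card S" if "T \<in> C" for T unfolding cS using that finC by simp
    have Sc: "S \<subseteq> carrier G" and Scard: "p ^ card S * card ?P \<le> card (generate G (?P \<union> S))"
      using S by (auto simp: C_def)
    have finS: "finite S" using Sc fin finite_subset by blast
    let ?H = "generate G (?P \<union> S)"
    have PS: "?P \<union> S \<subseteq> carrier G" using Sc by auto
    have H: "subgroup ?H G" by (rule generate_is_subgroup[OF PS])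
    have "?H = carrier G"
    proof (rule ccontr)
      assume "?H \<noteq> carrier G"
      then obtain x where x: "x \<in> carrier G" "x \<notin> ?H" using subgroup.subset[OF H] by blast
      let ?L = "generate G (?P \<union> insert x S)"
      have L: "subgroup ?L G" using PS x by (intro generate_is_subgroup) auto
      have "x \<in> ?L" using generate.incl[of x "?P \<union> insert x S" G] by simp
      moreover have "?H \<subseteq> ?L" by (rule mono_generate) blast
      ultimately have "?H \<subset> ?L" using x by blast
      then have "p * card ?H \<le> card ?L"
        by (rule p_group_proper_subgroup_card[OF p group_axioms k H L])
      moreover have "x \<notin> S" using x generate.incl[of x "?P \<union> S" G] by blast
      moreover have "p * (p ^ card S * card ?P) \<le> p * card ?H" using Scard by simp
      ultimately have "p * (p ^ card S * card ?P) \<le> card ?L" and "x \<notin> S" by linarith+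
      then have "p ^ card (insert x S) * card ?P \<le> card ?L" using finS by (simp add: mult.assoc)
      then have "insert x S \<in> C" using x Sc by (simp add: C_def)
      then show False using max[of "insert x S"] \<open>x \<notin> S\<close> finS by simp
    qed
    then have "generate G S = carrier G" by (rule generate_power_image_Un[OF k Sc])
    then have "gens (card S)" unfolding gens_def using Sc finS by blast
    moreover have "p ^ card S * card ?P \<le> card ?K * card ?P"
      using Scard \<open>?H = carrier G\<close> KP k by (simp add: Coset.order_def)
    ultimately show ?thesis using P0 by auto
  qed
  have min: "min_generators G = (LEAST n. gens n)" by (simp add: min_generators_def gens_def)
  obtain n where n: "gens n" "p ^ n \<le> card ?K" using lower by blast
  have "gens (min_generators G)" "min_generators G \<le> n"
    unfolding min using LeastI[of gens n] Least_le[of gens n] n(1) by auto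
  moreover have "p ^ min_generators G \<le> p ^ n"
    using calculation(2) p0 by (simp add: power_increasing)
  ultimately show ?thesis using upper[of "min_generators G"] n(2) by simp
qed

section \<open>The representation dimension of VZ p-groups\<close>

text \<open>Greedy choice: each representation used cuts the common kernel by a factor of at least p.\<close>

lemma representation_cutting_kernel:
  assumes p: "prime (p::nat)" and G: "group G" "Coset.order G = p ^ k"
    and U: "subgroup U G"
  shows "subgroup W G \<Longrightarrow> U \<subseteq> W \<Longrightarrow>
    (\<And>z. z \<in> W - U \<Longrightarrow> \<exists>\<sigma>. representation G m \<sigma> \<and> \<sigma> z \<noteq> 1\<^sub>m m \<and> (\<forall>u\<in>U. \<sigma> u = 1\<^sub>m m)) \<Longrightarrow>
    \<exists>b \<rho>. representation G (b * m) \<rho> \<and> p ^ b * card U \<le> card W \<and> {w\<in>W. \<rho> w = 1\<^sub>m (b * m)} \<subseteq> U"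
proof (induction "card W" arbitrary: W rule: less_induct)
  case less
  interpret group G by fact
  have "0 < Coset.order G" using p G(2) by (simp add: prime_gt_0_nat)
  then have fin: "finite (carrier G)" by (simp add: order_gt_0_iff_finite)
  have finW: "finite W" using less.prems(1) fin by (meson finite_subset subgroup.subset)
  show ?case
  proof (cases "W = U")
    case True
    have "representation G (0 * m) (\<lambda>_. 1\<^sub>m 0)" by (simp add: representation_iff[OF G(1)])
    then show ?thesis using True by (intro exI[of _ 0] exI[of _ "\<lambda>_. 1\<^sub>m 0"]) auto
  next
    case False
    then obtain z where z: "z \<in> W - U" using less.prems(2) by blast
    obtain \<sigma> where \<sigma>: "representation G m \<sigma>" "\<sigma> z \<noteq> 1\<^sub>m m" "\<forall>u\<in>U. \<sigma> u = 1\<^sub>m m"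
      using less.prems(3)[OF z] by blast
    \<comment> \<open>The part of \<open>W\<close> that \<open>\<sigma>\<close> fails to separate.
      It still contains \<open>U\<close>, because \<open>\<sigma>\<close> is trivial there, and it
      has lost \<open>z\<close>, so the induction continues with a group smaller by at least a
      factor p.\<close>
    define W' where "W' = {w\<in>W. \<sigma> w = 1\<^sub>m m}"
    have W': "subgroup W' G" unfolding W'_def by (rule representation_kernel_subgroup[OF G(1) \<sigma>(1) less.prems(1)])
    have sub: "W' \<subset> W" "U \<subseteq> W'" using z \<sigma> less.prems(2) by (auto simp: W'_def)
    have card: "p * card W' \<le> card W"
      by (rule p_group_proper_subgroup_card[OF p G W' less.prems(1) sub(1)])
    have "card W' < card W" using psubset_card_mono[OF finW sub(1)] .
    moreover have "\<exists>\<sigma>. representation G m \<sigma> \<and> \<sigma> z \<noteq> 1\<^sub>m m \<and> (\<forall>u\<in>U. \<sigma> u = 1\<^sub>m m)" if "z \<in> W' - U" for z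
      using less.prems(3)[of z] that sub by blast
    ultimately obtain b \<rho> where \<rho>: "representation G (b * m) \<rho>" "p ^ b * card U \<le> card W'"
      "{w\<in>W'. \<rho> w = 1\<^sub>m (b * m)} \<subseteq> U"
      using less.hyps[OF _ W' sub(2)] by blast
    obtain \<tau> where \<tau>: "representation G (m + b * m) \<tau>"
      "\<forall>g\<in>carrier G. \<tau> g = 1\<^sub>m (m + b * m) \<longleftrightarrow> \<sigma> g = 1\<^sub>m m \<and> \<rho> g = 1\<^sub>m (b * m)"
      using representation_direct_sum[OF G(1) \<sigma>(1) \<rho>(1)] by blast
    have "{w\<in>W. \<tau> w = 1\<^sub>m (m + b * m)} \<subseteq> U"
    proof
      fix w assume "w \<in> {w\<in>W. \<tau> w = 1\<^sub>m (m + b * m)}"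
      moreover from this have "w \<in> carrier G" using subgroup.mem_carrier[OF less.prems(1)] by blast
      ultimately show "w \<in> U" using \<tau>(2) \<rho>(3) by (auto simp: W'_def)
    qed
    moreover have "p * (p ^ b * card U) \<le> p * card W'" using \<rho>(2) by (rule mult_le_mono2)
    then have "p * (p ^ b * card U) \<le> card W" using card by linarith
    then have "p ^ Suc b * card U \<le> card W" by (simp add: mult.assoc)
    ultimately show ?thesis using \<tau>(1) by (intro exI[of _ "Suc b"] exI[of _ \<tau>]) simp
  qed
qed

text \<open>A central subgroup is an abelian p-group in its own right; the count made inside it is
  carried back to G. It is applied to the centre and to the commutator subgroup.\<close>

lemma central_power_kernel:
  assumes p: "prime (p::nat)" and G: "group G" "Coset.order G = p ^ k"
    and H: "subgroup H G" "H \<subseteq> center G"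
  shows "subgroup {x\<in>H. x [^]\<^bsub>G\<^esub> p = \<one>\<^bsub>G\<^esub>} G"
    and "card {x\<in>H. x [^]\<^bsub>G\<^esub> p = \<one>\<^bsub>G\<^esub>} = p ^ min_generators (G\<lparr>carrier := H\<rparr>)"
proof -
  interpret group G by fact
  let ?H = "G\<lparr>carrier := H\<rparr>"
  have grp: "group ?H" by (rule subgroup_imp_group[OF H(1)])
  have "comm_group ?H"
    by (rule group.group_comm_groupI[OF grp])
       (use H(2) subgroup.mem_carrier[OF H(1)] in \<open>auto simp: center_def\<close>)
  then interpret H: comm_group ?H .
  obtain a where a: "Coset.order ?H = p ^ a"
    using p_group_subgroup_card[OF p G H(1)] by (auto simp: Coset.order_def)
  have eq: "{x\<in>carrier ?H. x [^]\<^bsub>?H\<^esub> p = \<one>\<^bsub>?H\<^esub>} = {x\<in>H. x [^]\<^bsub>G\<^esub> p = \<one>\<^bsub>G\<^esub>}"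
    by (simp flip: nat_pow_consistent)
  show "card {x\<in>H. x [^]\<^bsub>G\<^esub> p = \<one>\<^bsub>G\<^esub>} = p ^ min_generators ?H"
    using H.card_power_kernel_eq_min_generators[OF p a] unfolding eq .
  have "subgroup {x\<in>H. x [^]\<^bsub>G\<^esub> p = \<one>\<^bsub>G\<^esub>} ?H"
    using H.power_kernel_subgroup[of p] unfolding eq .
  then show "subgroup {x\<in>H. x [^]\<^bsub>G\<^esub> p = \<one>\<^bsub>G\<^esub>} G"
    by (rule incl_subgroup[OF H(1)])
qed

section \<open>Central scalars, the common nonlinear degree, and a criterion for
  faithfulness\<close>

text \<open>Each irreducible acts on a central element of exponent p by a p-th root of unity. If the
  tuples of these roots agree for v and w, then the quotient of v by w is in every kernel, so the
  tuple map is injective.\<close>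

lemma card_le_separating_irreducibles:
  assumes p: "0 < (p::nat)" and G: "group G" and J: "finite J"
    and irr: "\<And>i. i \<in> J \<Longrightarrow> irreducible_representation G (n i) (\<sigma> i)"
    and V: "subgroup V G" "V \<subseteq> center G" "\<And>v. v \<in> V \<Longrightarrow> v [^]\<^bsub>G\<^esub> p = \<one>\<^bsub>G\<^esub>"
    and sep: "\<And>v. v \<in> V \<Longrightarrow> (\<And>i. i \<in> J \<Longrightarrow> \<sigma> i v = 1\<^sub>m (n i)) \<Longrightarrow> v = \<one>\<^bsub>G\<^esub>"
  shows "card V \<le> p ^ card J"
proof -
  interpret group G by fact
  interpret V: subgroup V G by fact
  define R where "R = {c::complex. c ^ p = 1}"
  have R: "finite R" "card R = p"
    unfolding R_def using p finite_roots_unity card_roots_unity_eq by auto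
  \<comment> \<open>The (0,0) entry recovers the scalar, as dimensions are positive. Restriction to
    \<open>J\<close> places the tuple in a finite extensional function space.\<close>
  define f where "f v = (\<lambda>i\<in>J. \<sigma> i v $$ (0,0))" for v
  note rep = irreducible_representationD(1)[OF irr] and n = irreducible_representationD(2)[OF irr]
  have scal: "\<sigma> i v = (\<sigma> i v $$ (0,0)) \<cdot>\<^sub>m 1\<^sub>m (n i)" if i: "i \<in> J" and v: "v \<in> V" for i v
  proof -
    have "v \<in> center G" using V(2) v by blast
    from central_scalar[OF G irr[OF i] this] obtain c where "\<sigma> i v = c \<cdot>\<^sub>m 1\<^sub>m (n i)" by blast
    then show ?thesis using n[OF i] by simp
  qed
  have pow: "\<sigma> i (v [^]\<^bsub>G\<^esub> j) $$ (0,0) = (\<sigma> i v $$ (0,0)) ^ j" if i: "i \<in> J" and v: "v \<in> V" for i v and j :: nat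
  proof (induction j)
    case 0
    then show ?case using representation_one[OF G rep[OF i]] n[OF i] by simp
  next
    case (Suc j)
    have vj: "v [^]\<^bsub>G\<^esub> j \<in> V" by (rule subgroup_nat_pow_closed[OF V(1) v])
    have "\<sigma> i (v [^]\<^bsub>G\<^esub> Suc j) = \<sigma> i (v [^]\<^bsub>G\<^esub> j) * \<sigma> i v"
      using representation_mult[OF G rep[OF i], of "v [^]\<^bsub>G\<^esub> j" v] v by simp
    also have "\<dots> = (\<sigma> i (v [^]\<^bsub>G\<^esub> j) $$ (0,0)) \<cdot>\<^sub>m \<sigma> i v"
      using representation_carrier[OF G rep[OF i], of v] v
      by (subst scal[OF i vj]) (simp add: mult_smult_assoc_mat[of _ "n i" "n i" _ "n i"])
    finally show ?case
      using Suc representation_carrier[OF G rep[OF i], of v] v n[OF i] by simp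
  qed
  have "f ` V \<subseteq> (\<Pi>\<^sub>E i\<in>J. R)"
  proof
    fix y assume "y \<in> f ` V"
    then obtain v where v: "v \<in> V" "y = f v" by blast
    have "(\<sigma> i v $$ (0,0)) ^ p = 1" if "i \<in> J" for i
      using pow[OF that v(1), of p] V(3)[OF v(1)] representation_one[OF G rep[OF that]] n[OF that] by simp
    then show "y \<in> (\<Pi>\<^sub>E i\<in>J. R)" using v by (auto simp: f_def R_def)
  qed
  moreover have "inj_on f V"
  proof (rule inj_onI)
    fix v w assume v: "v \<in> V" and w: "w \<in> V" and eq: "f v = f w"
    have vw: "v \<otimes>\<^bsub>G\<^esub> inv\<^bsub>G\<^esub> w \<in> V" using v w by simp
    have "\<sigma> i (v \<otimes>\<^bsub>G\<^esub> inv\<^bsub>G\<^esub> w) = 1\<^sub>m (n i)" if i: "i \<in> J" for i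
    proof -
      have "\<sigma> i v $$ (0,0) = \<sigma> i w $$ (0,0)" using fun_cong[OF eq, of i] i by (simp add: f_def)
      then have "\<sigma> i v = \<sigma> i w" using scal[OF i v] scal[OF i w] by simp
      then show ?thesis
        using representation_mult[OF G rep[OF i], of v "inv\<^bsub>G\<^esub> w"] representation_inv(1)[OF G rep[OF i], of w] v w
        by simp
    qed
    then have "v \<otimes>\<^bsub>G\<^esub> inv\<^bsub>G\<^esub> w = \<one>\<^bsub>G\<^esub>" by (rule sep[OF vw])
    then show "v = w" using v w by (metis V.mem_carrier inv_closed inv_equality inv_inv)
  qed
  ultimately have "card V \<le> card (\<Pi>\<^sub>E i\<in>J. R)"
    using R(1) J by (intro card_inj_on_le) (auto intro: finite_PiE)
  then show ?thesis using R J by (simp add: card_PiE)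
qed

text \<open>The square of a nonlinear degree is always |G:Z|, so the degree is unique. Without
  nonlinear irreducibles any \<open>m\<close> serves and the square root may be wrong; but then
  linear characters detect every nonidentity element, which forces G' to be trivial, and the guarded
  second clause says nothing.\<close>

lemma VZ_nonlinear_degree:
  assumes VZ: "VZ_group G"
  shows "\<exists>m. (\<forall>n \<sigma>. irreducible_representation G n \<sigma> \<longrightarrow> n \<noteq> 1 \<longrightarrow> n = m \<and> 0 < m) \<and>
    (derived G (carrier G) \<noteq> {\<one>\<^bsub>G\<^esub>} \<longrightarrow> real m = sqrt (real (card (rcosets\<^bsub>G\<^esub> (center G)))))"
proof (cases "\<exists>n \<sigma>. irreducible_representation G n \<sigma> \<and> n \<noteq> 1")
  case True
  then obtain m \<sigma> where m: "irreducible_representation G m \<sigma>" "m \<noteq> 1" by blast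
  have sq: "n * n = m * m" if "irreducible_representation G n \<tau>" "n \<noteq> 1" for n \<tau>
    using VZ_degree_square[OF VZ that] VZ_degree_square[OF VZ m] by simp
  have "n = m \<and> 0 < m" if "irreducible_representation G n \<tau>" "n \<noteq> 1" for n \<tau>
    using sq[OF that] irreducible_representationD(2)[OF m(1)] by (simp add: power2_eq_square[symmetric])
  moreover have "real m = sqrt (real (card (rcosets\<^bsub>G\<^esub> (center G))))"
    unfolding VZ_degree_square[OF VZ m, symmetric] by simp
  ultimately show ?thesis by blast
next
  case False
  have G: "group G" and fin: "finite (carrier G)" using VZ by (auto simp: VZ_group_def)
  interpret group G by fact
  have D: "subgroup (derived G (carrier G)) G" by (rule derived_is_subgroup) simp
  have "derived G (carrier G) \<subseteq> {\<one>\<^bsub>G\<^esub>}"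
  proof
    fix u assume u: "u \<in> derived G (carrier G)"
    show "u \<in> {\<one>\<^bsub>G\<^esub>}"
    proof (rule ccontr)
      assume "u \<notin> {\<one>\<^bsub>G\<^esub>}"
      then obtain n \<sigma> where "irreducible_representation G n \<sigma>" "\<sigma> u \<noteq> 1\<^sub>m n"
        using irreducible_nontrivial_at[OF G fin subgroup.mem_carrier[OF D u]] by blast
      moreover from this False have "n = 1" by blast
      ultimately show False using linear_trivial_on_derived[OF G _ u] irreducible_representationD(1) by blast
    qed
  qed
  then have "derived G (carrier G) = {\<one>\<^bsub>G\<^esub>}" using subgroup.one_closed[OF D] by blast
  then show ?thesis using False by blast
qed

text \<open>The kernel meets the centre trivially, since a nontrivial element there would have a
  power of order p. Commutators of kernel elements lie in the kernel and in G', hence in the centre,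
  so they vanish; the kernel is central and therefore trivial.\<close>

lemma central_derived_faithful:
  assumes p: "prime (p::nat)" and G: "group G" "Coset.order G = p ^ k"
    and D: "derived G (carrier G) \<subseteq> center G" and \<rho>: "representation G n \<rho>"
    and inj: "\<And>z. z \<in> center G \<Longrightarrow> z [^]\<^bsub>G\<^esub> p = \<one>\<^bsub>G\<^esub> \<Longrightarrow> \<rho> z = 1\<^sub>m n \<Longrightarrow> z = \<one>\<^bsub>G\<^esub>"
  shows "faithful_representation G n \<rho>"
proof -
  interpret group G by fact
  define K where "K = {w\<in>carrier G. \<rho> w = 1\<^sub>m n}"
  have K: "subgroup K G" unfolding K_def by (rule representation_kernel_subgroup[OF G(1) \<rho> subgroup_self])
  have Z: "subgroup (center G) G" by (rule center_subgroup[OF G(1)])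
  \<comment> \<open>Induction on the exponent j bounding the order: the p-th power of z is handled
    by the hypothesis, hence trivial, and then \<open>inj\<close> applies to z.\<close>
  have KZ: "z = \<one>\<^bsub>G\<^esub>" if "z \<in> K" "z \<in> center G" "z [^]\<^bsub>G\<^esub> (p ^ j) = \<one>\<^bsub>G\<^esub>" for z j
    using that
  proof (induction j arbitrary: z)
    case 0
    then show ?case using subgroup.mem_carrier[OF K] by simp
  next
    case (Suc j)
    have "(z [^]\<^bsub>G\<^esub> p) [^]\<^bsub>G\<^esub> (p ^ j) = \<one>\<^bsub>G\<^esub>" using Suc.prems(3) subgroup.mem_carrier[OF K Suc.prems(1)] by (simp add: nat_pow_pow)
    then have zp: "z [^]\<^bsub>G\<^esub> p = \<one>\<^bsub>G\<^esub>"
      by (rule Suc.IH[OF subgroup_nat_pow_closed[OF K Suc.prems(1)] subgroup_nat_pow_closed[OF Z Suc.prems(2)]])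
    have "\<rho> z = 1\<^sub>m n" using Suc.prems(1) unfolding K_def by blast
    then show ?case by (rule inj[OF Suc.prems(2) zp])
  qed
  have KZ1: "z = \<one>\<^bsub>G\<^esub>" if "z \<in> K" "z \<in> center G" for z
  proof (rule KZ[OF that])
    show "z [^]\<^bsub>G\<^esub> (p ^ k) = \<one>\<^bsub>G\<^esub>"
      using pow_order_eq_1[OF subgroup.mem_carrier[OF K that(1)]] unfolding G(2) .
  qed
  have K1: "g = \<one>\<^bsub>G\<^esub>" if g: "g \<in> K" for g
  proof -
    have "g \<otimes>\<^bsub>G\<^esub> h = h \<otimes>\<^bsub>G\<^esub> g" if h: "h \<in> carrier G" for h
    proof -
      \<comment> \<open>The commutator lies in the kernel because \<open>\<rho> g\<close> and its
        inverse are the identity, leaving \<open>\<rho> h\<close> times its inverse.\<close>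
      define c where "c = g \<otimes>\<^bsub>G\<^esub> h \<otimes>\<^bsub>G\<^esub> inv\<^bsub>G\<^esub> g \<otimes>\<^bsub>G\<^esub> inv\<^bsub>G\<^esub> h"
      have gc: "g \<in> carrier G" "inv\<^bsub>G\<^esub> g \<in> K" "\<rho> g = 1\<^sub>m n" "\<rho> (inv\<^bsub>G\<^esub> g) = 1\<^sub>m n"
        using g subgroup.m_inv_closed[OF K g] by (auto simp: K_def)
      have "c \<in> derived G (carrier G)"
        unfolding c_def derived_def using gc(1) h by (intro generate.incl) blast
      moreover have "\<rho> c = \<rho> h * \<rho> (inv\<^bsub>G\<^esub> h)"
        unfolding c_def using gc h representation_carrier[OF G(1) \<rho> h] representation_mult[OF G(1) \<rho>] by simp
      then have "c \<in> K" using representation_inv(1)[OF G(1) \<rho> h] gc h by (simp add: K_def c_def)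
      ultimately have "c = \<one>\<^bsub>G\<^esub>" using KZ1 D by blast
      moreover have "g \<otimes>\<^bsub>G\<^esub> h = c \<otimes>\<^bsub>G\<^esub> (h \<otimes>\<^bsub>G\<^esub> g)"
      proof -
        have "inv\<^bsub>G\<^esub> h \<otimes>\<^bsub>G\<^esub> (h \<otimes>\<^bsub>G\<^esub> g) = g" using gc(1) h by (simp flip: m_assoc)
        then show ?thesis unfolding c_def using gc(1) h by (simp add: m_assoc)
      qed
      ultimately show ?thesis using gc(1) h by simp
    qed
    then have "g \<in> center G" using g by (auto simp: center_def K_def)
    then show ?thesis by (rule KZ1[OF g])
  qed
  have "inj_on \<rho> (carrier G)"
  proof (rule inj_onI)
    fix x y assume x: "x \<in> carrier G" and y: "y \<in> carrier G" and eq: "\<rho> x = \<rho> y"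
    have "\<rho> (x \<otimes>\<^bsub>G\<^esub> inv\<^bsub>G\<^esub> y) = 1\<^sub>m n"
      using representation_mult[OF G(1) \<rho> x, of "inv\<^bsub>G\<^esub> y"] representation_inv(1)[OF G(1) \<rho> y] eq y by simp
    then have "x \<otimes>\<^bsub>G\<^esub> inv\<^bsub>G\<^esub> y = \<one>\<^bsub>G\<^esub>" using K1 x y by (simp add: K_def)
    then show "x = y" using x y by (metis inv_closed inv_equality inv_inv)
  qed
  then show ?thesis using \<rho> by (simp add: faithful_representation_def)
qed

section \<open>The two bounds and their comparison\<close>

text \<open>\<open>b\<close> counts linear pieces and \<open>a\<close> nonlinear ones. The counts
  are only bounded above here: each linear piece uses up a factor p of the index of Omega(G') in
  Omega(Z), each nonlinear one a factor p of Omega(G').\<close>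

lemma VZ_faithful_representation_exists:
  assumes p: "prime (p::nat)" and VZ: "VZ_group G" and k: "Coset.order G = p ^ k"
    and m: "\<And>n \<sigma>. irreducible_representation G n \<sigma> \<Longrightarrow> n \<noteq> 1 \<Longrightarrow> n = m"
  shows "\<exists>a b \<rho>. faithful_representation G (b + a * m) \<rho> \<and>
    b + min_generators (G\<lparr>carrier := derived G (carrier G)\<rparr>) \<le> min_generators (G\<lparr>carrier := center G\<rparr>) \<and>
    a \<le> min_generators (G\<lparr>carrier := derived G (carrier G)\<rparr>)"
proof -
  have G: "group G" and fin: "finite (carrier G)" using VZ by (auto simp: VZ_group_def)
  interpret group G by fact
  let ?Z = "center G" and ?D = "derived G (carrier G)"
  let ?dZ = "min_generators (G\<lparr>carrier := ?Z\<rparr>)" and ?dD = "min_generators (G\<lparr>carrier := ?D\<rparr>)"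
  define V where "V = {z\<in>?Z. z [^]\<^bsub>G\<^esub> p = \<one>\<^bsub>G\<^esub>}"
  define U where "U = {z\<in>?D. z [^]\<^bsub>G\<^esub> p = \<one>\<^bsub>G\<^esub>}"
  have Z: "subgroup ?Z G" by (rule center_subgroup[OF G])
  have D: "subgroup ?D G" by (rule derived_is_subgroup) simp
  have DZ: "?D \<subseteq> ?Z" by (rule VZ_derived_central[OF VZ])
  have V: "subgroup V G" "card V = p ^ ?dZ"
    unfolding V_def using central_power_kernel[OF p G k Z] by auto
  have U: "subgroup U G" "card U = p ^ ?dD"
    unfolding U_def using central_power_kernel[OF p G k D DZ] by auto
  have UV: "U \<subseteq> V" using DZ by (auto simp: U_def V_def)
  have p1: "1 < p" using p by (rule prime_gt_1_nat)
  \<comment> \<open>\<open>U\<close> is the intersection of \<open>V\<close> with G', so an element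
    of \<open>V\<close> outside \<open>U\<close> lies outside G' and some linear character sees
    it.\<close>
  have lin: "\<exists>\<sigma>. representation G 1 \<sigma> \<and> \<sigma> z \<noteq> 1\<^sub>m 1 \<and> (\<forall>u\<in>U. \<sigma> u = 1\<^sub>m 1)" if z: "z \<in> V - U" for z
  proof -
    have "z \<in> carrier G" "z \<notin> ?D" using z by (auto simp: U_def V_def center_def)
    then obtain \<sigma> where "representation G 1 \<sigma>" "\<sigma> z \<noteq> 1\<^sub>m 1" using linear_nontrivial_at[OF G fin] by blast
    then show ?thesis using linear_trivial_on_derived[OF G] by (auto simp: U_def)
  qed
  obtain b \<rho> where \<rho>: "representation G (b * 1) \<rho>" "p ^ b * card U \<le> card V" "{w\<in>V. \<rho> w = 1\<^sub>m (b * 1)} \<subseteq> U"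
    using representation_cutting_kernel[OF p G k U(1) V(1) UV lin] by blast
  have one: "subgroup {\<one>\<^bsub>G\<^esub>} G" by (rule triv_subgroup)
  \<comment> \<open>Linear representations are blind to G', so whatever detects \<open>z\<close> is
    nonlinear and has degree \<open>m\<close>. Without nonlinear irreducibles the claim is
    vacuous.\<close>
  have nonlin: "\<exists>\<sigma>. representation G m \<sigma> \<and> \<sigma> z \<noteq> 1\<^sub>m m \<and> (\<forall>u\<in>{\<one>\<^bsub>G\<^esub>}. \<sigma> u = 1\<^sub>m m)"
    if z: "z \<in> U - {\<one>\<^bsub>G\<^esub>}" for z
  proof -
    have zD: "z \<in> ?D" "z \<in> carrier G" "z \<noteq> \<one>\<^bsub>G\<^esub>"
      using z subgroup.mem_carrier[OF D] by (auto simp: U_def)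
    obtain n \<sigma> where irr: "irreducible_representation G n \<sigma>" and \<sigma>: "\<sigma> z \<noteq> 1\<^sub>m n"
      using irreducible_nontrivial_at[OF G fin zD(2,3)] by blast
    note rep = irreducible_representationD(1)[OF irr]
    have "n \<noteq> 1"
    proof
      assume "n = 1"
      then show False using linear_trivial_on_derived[OF G _ zD(1)] rep \<sigma> by blast
    qed
    then have "n = m" by (rule m[OF irr])
    then show ?thesis using rep \<sigma> representation_one[OF G rep] by blast
  qed
  obtain a \<sigma> where \<sigma>: "representation G (a * m) \<sigma>" "p ^ a * card {\<one>\<^bsub>G\<^esub>} \<le> card U"
    "{w\<in>U. \<sigma> w = 1\<^sub>m (a * m)} \<subseteq> {\<one>\<^bsub>G\<^esub>}"
    using representation_cutting_kernel[OF p G k one U(1) _ nonlin] subgroup.one_closed[OF U(1)] by blast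
  obtain \<tau> where \<tau>: "representation G (b * 1 + a * m) \<tau>"
    "\<forall>g\<in>carrier G. \<tau> g = 1\<^sub>m (b * 1 + a * m) \<longleftrightarrow> \<rho> g = 1\<^sub>m (b * 1) \<and> \<sigma> g = 1\<^sub>m (a * m)"
    using representation_direct_sum[OF G \<rho>(1) \<sigma>(1)] by blast
  have "faithful_representation G (b * 1 + a * m) \<tau>"
  proof (rule central_derived_faithful[OF p G k DZ \<tau>(1)])
    fix z assume z: "z \<in> ?Z" "z [^]\<^bsub>G\<^esub> p = \<one>\<^bsub>G\<^esub>" "\<tau> z = 1\<^sub>m (b * 1 + a * m)"
    have "z \<in> carrier G" using z(1) by (simp add: center_def)
    then have "\<rho> z = 1\<^sub>m (b * 1)" "\<sigma> z = 1\<^sub>m (a * m)" using \<tau>(2) z(3) by auto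
    moreover from this z have "z \<in> U" using \<rho>(3) by (auto simp: V_def)
    ultimately show "z = \<one>\<^bsub>G\<^esub>" using \<sigma>(3) by blast
  qed
  moreover have "p ^ (b + ?dD) \<le> p ^ ?dZ" using \<rho>(2) U(2) V(2) by (simp add: power_add)
  then have "b + ?dD \<le> ?dZ" using p1 power_le_imp_le_exp by blast
  moreover have "p ^ a \<le> p ^ ?dD" using \<sigma>(2) U(2) by simp
  then have "a \<le> ?dD" using p1 power_le_imp_le_exp by blast
  ultimately show ?thesis by (intro exI[of _ a] exI[of _ b] exI[of _ \<tau>]) simp
qed

text \<open>All constituents together must separate Omega(Z), and the nonlinear ones alone must
  separate Omega(G'). The rank of G' is added on the right instead of subtracted on the left, since
  natural subtraction truncates.\<close>

lemma VZ_faithful_representation_dim_ge: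
  assumes p: "prime (p::nat)" and VZ: "VZ_group G" and k: "Coset.order G = p ^ k"
    and m: "\<And>n \<sigma>. irreducible_representation G n \<sigma> \<Longrightarrow> n \<noteq> 1 \<Longrightarrow> n = m \<and> 0 < m"
    and \<rho>: "faithful_representation G n \<rho>"
  shows "min_generators (G\<lparr>carrier := center G\<rparr>) + min_generators (G\<lparr>carrier := derived G (carrier G)\<rparr>) * m
    \<le> n + min_generators (G\<lparr>carrier := derived G (carrier G)\<rparr>)"
proof -
  have G: "group G" and fin: "finite (carrier G)" using VZ by (auto simp: VZ_group_def)
  interpret group G by fact
  let ?Z = "center G" and ?D = "derived G (carrier G)"
  let ?dZ = "min_generators (G\<lparr>carrier := ?Z\<rparr>)" and ?dD = "min_generators (G\<lparr>carrier := ?D\<rparr>)"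
  have p1: "1 < p" using p by (rule prime_gt_1_nat)
  then have p0: "0 < p" by simp
  define V where "V = {z\<in>?Z. z [^]\<^bsub>G\<^esub> p = \<one>\<^bsub>G\<^esub>}"
  define U where "U = {z\<in>?D. z [^]\<^bsub>G\<^esub> p = \<one>\<^bsub>G\<^esub>}"
  have Z: "subgroup ?Z G" by (rule center_subgroup[OF G])
  have D: "subgroup ?D G" by (rule derived_is_subgroup) simp
  have DZ: "?D \<subseteq> ?Z" by (rule VZ_derived_central[OF VZ])
  have V: "subgroup V G" "card V = p ^ ?dZ"
    unfolding V_def using central_power_kernel[OF p G k Z] by auto
  have U: "subgroup U G" "card U = p ^ ?dD"
    unfolding U_def using central_power_kernel[OF p G k D DZ] by auto
  have rep: "representation G n \<rho>" and inj: "inj_on \<rho> (carrier G)"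
    using \<rho> by (auto simp: faithful_representation_def)
  obtain xs where xs: "\<forall>(m,\<sigma>)\<in>set xs. irreducible_representation G m \<sigma>" "n = (\<Sum>(m,\<sigma>)\<leftarrow>xs. m)"
    "\<forall>g\<in>carrier G. (\<forall>(m,\<sigma>)\<in>set xs. \<sigma> g = 1\<^sub>m m) \<longrightarrow> \<rho> g = 1\<^sub>m n"
    using composition_factors[OF G fin rep] by blast
  define d where "d i = fst (xs ! i)" for i
  define \<sigma> where "\<sigma> i = snd (xs ! i)" for i
  \<comment> \<open>Positions in the list, not the constituents themselves, so that repeated
    constituents count with multiplicity in the dimension.\<close>
  define I where "I = {..<length xs}"
  define I1 where "I1 = {i\<in>I. d i \<noteq> 1}"
  have irr: "irreducible_representation G (d i) (\<sigma> i)" if "i \<in> I" for i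
  proof -
    have "(d i, \<sigma> i) \<in> set xs" using nth_mem[of i xs] that by (simp add: d_def \<sigma>_def I_def)
    then show ?thesis using xs(1) by blast
  qed
  have sep: "g = \<one>\<^bsub>G\<^esub>" if "g \<in> carrier G" "\<And>i. i \<in> I \<Longrightarrow> \<sigma> i g = 1\<^sub>m (d i)" for g
  proof -
    have "\<forall>(m,\<sigma>)\<in>set xs. \<sigma> g = 1\<^sub>m m"
      using that(2) by (auto simp: in_set_conv_nth d_def \<sigma>_def I_def) (metis fst_conv snd_conv)
    then have "\<rho> g = \<rho> \<one>\<^bsub>G\<^esub>" using xs(3) that(1) representation_one[OF G rep] by simp
    then show ?thesis using inj that(1) by (auto dest: inj_onD)
  qed
  have finI: "finite I" "finite I1" "I1 \<subseteq> I" by (auto simp: I_def I1_def)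
  have "card V \<le> p ^ card I"
  proof (rule card_le_separating_irreducibles[OF p0 G finI(1) irr V(1)])
    fix v assume "v \<in> V" "\<And>i. i \<in> I \<Longrightarrow> \<sigma> i v = 1\<^sub>m (d i)"
    then show "v = \<one>\<^bsub>G\<^esub>" using sep subgroup.mem_carrier[OF V(1)] by blast
  qed (auto simp: V_def)
  then have dZ: "?dZ \<le> card I" using V(2) p1 power_le_imp_le_exp by metis
  have "card U \<le> p ^ card I1"
  proof (rule card_le_separating_irreducibles[OF p0 G finI(2) _ U(1)])
    fix u assume u: "u \<in> U" and triv: "\<And>i. i \<in> I1 \<Longrightarrow> \<sigma> i u = 1\<^sub>m (d i)"
    have "\<sigma> i u = 1\<^sub>m (d i)" if i: "i \<in> I" for i
    proof (cases "d i = 1")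
      case True
      then have "representation G 1 (\<sigma> i)" using irreducible_representationD(1)[OF irr[OF i]] by simp
      then have "\<sigma> i u = 1\<^sub>m 1" by (rule linear_trivial_on_derived[OF G]) (use u in \<open>simp add: U_def\<close>)
      then show ?thesis using True by simp
    next
      case False
      then show ?thesis using triv i by (simp add: I1_def)
    qed
    then show "u = \<one>\<^bsub>G\<^esub>" using sep u subgroup.mem_carrier[OF U(1)] by blast
  qed (use irr DZ in \<open>auto simp: U_def I1_def\<close>)
  then have dD: "?dD \<le> card I1" using U(2) p1 power_le_imp_le_exp by metis
  \<comment> \<open>Positivity of \<open>m\<close> is known only through an actual nonlinear
    irreducible; without one in the list, the rank of G' is 0 by \<open>dD\<close>.\<close>
  have m1: "0 < m" if "0 < card I1"
  proof -
    obtain i where "i \<in> I1" using \<open>0 < card I1\<close> by (metis card_gt_0_iff ex_in_conv)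
    then show ?thesis using m[OF irr, of i] by (simp add: I1_def)
  qed
  have "n = (\<Sum>i\<in>I. d i)"
    unfolding xs(2) by (simp add: sum_list_sum_nth I_def d_def atLeast0LessThan case_prod_beta)
  also have "\<dots> = (\<Sum>i\<in>I1. d i) + (\<Sum>i\<in>I - I1. d i)"
    using finI by (simp add: sum.subset_diff add.commute)
  also have "(\<Sum>i\<in>I1. d i) = (\<Sum>i\<in>I1. m)"
    by (rule sum.cong) (use m[OF irr] in \<open>auto simp: I1_def\<close>)
  also have "(\<Sum>i\<in>I - I1. d i) = (\<Sum>i\<in>I - I1. 1)" by (rule sum.cong) (auto simp: I1_def)
  finally have "n = card I1 * m + card (I - I1)" by simp
  moreover have "card I = card I1 + card (I - I1)"
    using finI by (metis card_Diff_subset card_mono le_add_diff_inverse)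
  ultimately have n: "n + card I1 = card I1 * m + card I" by simp
  \<comment> \<open>Monotonicity of t(m - 1) in t, rearranged without subtraction.\<close>
  have "?dD * m + card I1 \<le> card I1 * m + ?dD"
  proof (cases "card I1 = 0")
    case True
    then show ?thesis using dD by simp
  next
    case False
    then obtain m' where m': "m = Suc m'" using m1 by (metis gr0_conv_Suc neq0_conv)
    show ?thesis unfolding m' using mult_le_mono1[OF dD, of m'] by simp
  qed
  then show ?thesis using n dZ by linarith
qed

text \<open>For the trivial group the right-hand side would be 0, whereas \<open>rep_dim\<close>
  only admits positive dimensions; hence the assumption that the carrier is nontrivial.\<close>

theorem proposition1:
  fixes G :: "('a, 'b) monoid_scheme" and p k :: nat
  assumes "prime p"
    and "group G" and "finite (carrier G)"
    and "Coset.order G = p ^ k"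
    and "carrier G \<noteq> {\<one>\<^bsub>G\<^esub>}"
    and "VZ_group G"
  shows "real (rep_dim G) =
    real (min_generators (G\<lparr>carrier := center G\<rparr>))
    - real (min_generators (G\<lparr>carrier := derived G (carrier G)\<rparr>))
    + real (min_generators (G\<lparr>carrier := derived G (carrier G)\<rparr>))
      * sqrt (real (card (rcosets\<^bsub>G\<^esub> (center G))))"
proof -
  interpret group G by fact
  let ?Z = "center G" and ?D = "derived G (carrier G)"
  let ?dZ = "min_generators (G\<lparr>carrier := ?Z\<rparr>)" and ?dD = "min_generators (G\<lparr>carrier := ?D\<rparr>)"
  obtain m where m: "\<And>n \<sigma>. irreducible_representation G n \<sigma> \<Longrightarrow> n \<noteq> 1 \<Longrightarrow> n = m \<and> 0 < m"
    and sqrt: "?D \<noteq> {\<one>\<^bsub>G\<^esub>} \<Longrightarrow> real m = sqrt (real (card (rcosets\<^bsub>G\<^esub> ?Z)))"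
    using VZ_nonlinear_degree[OF assms(6)] by blast
  obtain a b \<rho> where \<rho>: "faithful_representation G (b + a * m) \<rho>"
    and b: "b + ?dD \<le> ?dZ" and a: "a \<le> ?dD"
    using VZ_faithful_representation_exists[OF assms(1,6,4)] m by blast
  \<comment> \<open>The constructed representation must compete in the minimum over positive
    dimensions: all matrices of size 0 coincide, so only a trivial group is faithful in dimension
    0.\<close>
  have "b + a * m \<noteq> 0"
  proof
    assume "b + a * m = 0"
    then have rep: "representation G 0 \<rho>" and inj: "inj_on \<rho> (carrier G)"
      using \<rho> by (auto simp: faithful_representation_def)
    have "x = \<one>\<^bsub>G\<^esub>" if "x \<in> carrier G" for x
    proof -
      have "\<rho> x = \<rho> \<one>\<^bsub>G\<^esub>"
        using representation_carrier[OF assms(2) rep that] representation_carrier[OF assms(2) rep one_closed]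
        by (intro eq_matI) auto
      then show ?thesis using inj that by (auto dest: inj_onD)
    qed
    then show False using assms(5) one_closed by blast
  qed
  then have ex: "0 < b + a * m \<and> (\<exists>\<rho>. faithful_representation G (b + a * m) \<rho>)" using \<rho> by auto
  obtain \<sigma> where \<sigma>: "faithful_representation G (rep_dim G) \<sigma>"
    using LeastI[of "\<lambda>n. 0 < n \<and> (\<exists>\<rho>. faithful_representation G n \<rho>)", OF ex] unfolding rep_dim_def by blast
  have "rep_dim G \<le> b + a * m" unfolding rep_dim_def by (rule Least_le) (rule ex)
  moreover have "a * m \<le> ?dD * m" using a by (rule mult_le_mono1)
  moreover have "?dZ + ?dD * m \<le> rep_dim G + ?dD"
    by (rule VZ_faithful_representation_dim_ge[OF assms(1,6,4) m \<sigma>])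
  \<comment> \<open>The upper bounds on \<open>a\<close> and \<open>b\<close> give at most
    \<open>?dZ + ?dD * m\<close>, which is exactly the lower bound.\<close>
  ultimately have "rep_dim G + ?dD = ?dZ + ?dD * m" using b by linarith
  then have "real (rep_dim G + ?dD) = real (?dZ + ?dD * m)" by simp
  then have "real (rep_dim G) = real ?dZ - real ?dD + real ?dD * real m" by simp
  \<comment> \<open>If G' is trivial, \<open>m\<close> may be arbitrary, but the empty set generates
    G' and the factor in front is 0.\<close>
  moreover have "real ?dD * real m = real ?dD * sqrt (real (card (rcosets\<^bsub>G\<^esub> ?Z)))"
  proof (cases "?D = {\<one>\<^bsub>G\<^esub>}")
    case True
    have "generate (G\<lparr>carrier := ?D\<rparr>) {} = {\<one>\<^bsub>G\<^esub>}"
      using generate_consistent[of "{}" ?D] derived_is_subgroup[of "carrier G"] generate_empty by simp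
    then have "?dD = 0" unfolding min_generators_def using True
      by (intro Least_equality) auto
    then show ?thesis by simp
  next
    case False
    then show ?thesis using sqrt by simp
  qed
  ultimately show ?thesis by simp
qed

end
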